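(* Let $A=A_n$ be a deterministic real symmetric $n\times n$ matrix, let $E=E_n$ be an $n\times n$ sub-Gaussian matrix, and let $\tilde A=A+E$. Fix a parameter $K=K(n)>0$ and let $r$ be the number of eigenvalues of $A$ (with multiplicity) greater than $\lambda_1-3K\sqrt n$. Then, with probability $1-o(1)$ as $n\to\infty$, $$\tilde\lambda_1-\lambda_1\ \le\ 135\,\log(3+\sigma_1)\cdot\max\left\{\frac{\sqrt n}{K},\ \sqrt{r\log n}\cdot n^{1/4}\right\}.$$
   Context: $\lambda_1\ge\dots\ge\lambda_n$ are the eigenvalues of $A$, $\tilde\lambda_1\ge\dots\ge\tilde\lambda_n$ those of $\tilde A$, and $\sigma_1=\|A\|$ is the largest singular value (spectral norm) of $A$. Sub-Gaussian norm: $\|\xi\|_{\psi_2}:=\inf\{c>0:\mathbf E[\exp(\xi^2/c^2)]<2\}$. A symmetric random matrix $E=(\xi_{ij})_{i,j=1}^n$ is a sub-Gaussian matrix if the entries $(\xi_{ij})_{1\le i\le j\le n}$ are independent, centered, and satisfy $C_1\le\mathbf E\xi_{ij}^2\le1$ and $\max_{i,j}\|\xi_{ij}\|_{\psi_2}\le C_2$, for some constants $C_1,C_2>0$ not depending on $n$. Asymptotic notation is as $n\to\infty$ with $C_1,C_2$ fixed. *)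

theory Defs
  imports
    "HOL-Probability.Probability"
    "HOL-Computational_Algebra.Fundamental_Theorem_Algebra"
    "Jordan_Normal_Form.Char_Poly"
begin

definition symmetric_mat :: "real mat \<Rightarrow> bool" where
  "symmetric_mat A \<longleftrightarrow> square_mat A \<and> transpose_mat A = A"

(* The i-th largest eigenvalue, counted with multiplicity and numbered from 1.
   For a real symmetric n x n matrix the characteristic polynomial splits over the reals,
   so the list has length n; outside 1 <= i <= n the value is meaningless. *)
definition nth_eigenvalue :: "real mat \<Rightarrow> nat \<Rightarrow> real" where
  "nth_eigenvalue A i = rev (sorted_list_of_multiset (proots (char_poly A))) ! (i - 1)"

definition nth_singular_value :: "real mat \<Rightarrow> nat \<Rightarrow> real" where
  "nth_singular_value A i = sqrt (nth_eigenvalue (transpose_mat A * A) i)"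

(* Extended-valued: the expectation is a Lebesgue integral in [0,\<infinity>], and the infimum of the
   empty set is \<infinity>, so that a variable that is not sub-Gaussian has infinite norm. *)
definition psi2_norm :: "'a measure \<Rightarrow> ('a \<Rightarrow> real) \<Rightarrow> ennreal" where
  "psi2_norm M X =
     Inf {ennreal c | c. c > 0 \<and> (\<integral>\<^sup>+ \<omega>. ennreal (exp ((X \<omega>)\<^sup>2 / c\<^sup>2)) \<partial>M) < 2}"

(* Measurability of the entries is part of indep_vars; together with the finite psi2 norm it
   makes all moments finite, so the Bochner expectations below are genuine ones. *)
definition sub_gaussian_matrix ::
    "real \<Rightarrow> real \<Rightarrow> 'a measure \<Rightarrow> nat \<Rightarrow> ('a \<Rightarrow> real mat) \<Rightarrow> bool" where
  "sub_gaussian_matrix C1 C2 M n E \<longleftrightarrow>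
     prob_space M \<and>
     (\<forall>\<omega>\<in>space M. E \<omega> \<in> carrier_mat n n \<and> symmetric_mat (E \<omega>)) \<and>
     prob_space.indep_vars M (\<lambda>_. borel) (\<lambda>(i, j) \<omega>. E \<omega> $$ (i, j)) {(i, j). i \<le> j \<and> j < n} \<and>
     (\<forall>i<n. \<forall>j<n.
        (\<integral>\<omega>. E \<omega> $$ (i, j) \<partial>M) = 0 \<and>
        C1 \<le> (\<integral>\<omega>. (E \<omega> $$ (i, j))\<^sup>2 \<partial>M) \<and>
        (\<integral>\<omega>. (E \<omega> $$ (i, j))\<^sup>2 \<partial>M) \<le> 1 \<and>
        psi2_norm M (\<lambda>\<omega>. E \<omega> $$ (i, j)) \<le> ennreal C2)"

end

theory Submission
  imports Defs
begin

text \<open>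
  The top eigenvector \<open>v\<close> of \<open>A + E\<close> is split as \<open>p + q\<close>, where \<open>p\<close> lies in the span of the
  \<open>r\<close> eigenvectors of \<open>A\<close> whose eigenvalues exceed \<open>\<lambda>\<^sub>1 - \<tau>\<close>, with \<open>\<tau> = 3 K sqrt n\<close>, and \<open>q\<close> is
  orthogonal to it. The form of \<open>A\<close> loses \<open>\<tau> |q|\<^sup>2\<close>, which absorbs the cross terms of \<open>E\<close>, and so
  the top eigenvalue moves by at most \<open>f + 2 W\<^sup>2 / \<tau>\<close>. Here \<open>W\<close> bounds the operator norm of \<open>E\<close> and
  \<open>f\<close> the Frobenius norm of its compression to the \<open>r\<close> eigenvectors. With high probability
  \<open>W \<le> C sqrt n\<close>, by a net of lattice points, and \<open>f \<le> r sqrt (ln n)\<close>, by a second moment.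

  If \<open>r \<ge> sqrt n\<close>, or if \<open>C K \<le> 135 ln (3 + \<sigma>\<^sub>1)\<close>, then already \<open>W\<close> is below the claimed bound.
  Otherwise \<open>r < n\<close>, and so \<open>3 K sqrt n \<le> 2 \<sigma>\<^sub>1\<close>. This makes \<open>\<sigma>\<^sub>1\<close> at least of order \<open>sqrt n\<close>, and
  for large \<open>n\<close> the factor \<open>ln (3 + \<sigma>\<^sub>1)\<close> exceeds the constant \<open>C\<^sup>2\<close> in front of
  \<open>W\<^sup>2 / \<tau>\<close>, whatever the sub-Gaussian constant is.
\<close>

section \<open>The spectral theorem for real symmetric matrices\<close>

text \<open>Vectors are functions on the naturals of which only the first \<open>n\<close> values matter, so that the
  dimension remains a variable.\<close>

definition ip :: "nat \<Rightarrow> (nat \<Rightarrow> real) \<Rightarrow> (nat \<Rightarrow> real) \<Rightarrow> real" where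
  "ip n x y = (\<Sum>i<n. x i * y i)"

definition mv :: "nat \<Rightarrow> (nat \<Rightarrow> nat \<Rightarrow> real) \<Rightarrow> (nat \<Rightarrow> real) \<Rightarrow> nat \<Rightarrow> real" where
  "mv n S x i = (\<Sum>j<n. S i j * x j)"

definition bf :: "nat \<Rightarrow> (nat \<Rightarrow> nat \<Rightarrow> real) \<Rightarrow> (nat \<Rightarrow> real) \<Rightarrow> (nat \<Rightarrow> real) \<Rightarrow> real" where
  "bf n S x y = ip n x (mv n S y)"

definition orthonormal :: "nat \<Rightarrow> nat \<Rightarrow> (nat \<Rightarrow> nat \<Rightarrow> real) \<Rightarrow> bool" where
  "orthonormal n m u \<longleftrightarrow> (\<forall>k<m. \<forall>l<m. ip n (u k) (u l) = (if k = l then 1 else 0))"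

lemma ip_commute: "ip n x y = ip n y x"
  by (simp add: ip_def mult.commute)

lemma ip_add_left: "ip n (\<lambda>i. x i + y i) z = ip n x z + ip n y z"
  by (simp add: ip_def distrib_right sum.distrib)

lemma ip_diff_left: "ip n (\<lambda>i. x i - y i) z = ip n x z - ip n y z"
  by (simp add: ip_def left_diff_distrib sum_subtractf)

lemma ip_scale_left: "ip n (\<lambda>i. c * x i) z = c * ip n x z"
  by (simp add: ip_def sum_distrib_left mult.assoc)

lemma ip_sum_left: "ip n (\<lambda>i. \<Sum>k\<in>K. f k i) z = (\<Sum>k\<in>K. ip n (f k) z)"
  unfolding ip_def sum_distrib_right by (rule sum.swap)

lemma ip_add_right: "ip n z (\<lambda>i. x i + y i) = ip n z x + ip n z y"
  by (metis ip_add_left ip_commute)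

lemma ip_diff_right: "ip n z (\<lambda>i. x i - y i) = ip n z x - ip n z y"
  by (metis ip_diff_left ip_commute)

lemma ip_scale_right: "ip n z (\<lambda>i. c * x i) = c * ip n z x"
  by (metis ip_scale_left ip_commute)

lemma ip_sum_right: "ip n z (\<lambda>i. \<Sum>k\<in>K. f k i) = (\<Sum>k\<in>K. ip n z (f k))"
  using ip_sum_left[of n f K z] by (simp add: ip_commute)

lemmas ip_linear = ip_add_left ip_diff_left ip_scale_left ip_sum_left
  ip_add_right ip_diff_right ip_scale_right ip_sum_right

lemma ip_cong: "(\<And>i. i < n \<Longrightarrow> x i = x' i) \<Longrightarrow> (\<And>i. i < n \<Longrightarrow> y i = y' i) \<Longrightarrow> ip n x y = ip n x' y'"
  by (simp add: ip_def)

lemma ip_self_nonneg [simp]: "0 \<le> ip n x x"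
  by (simp add: ip_def sum_nonneg)

lemma ip_self_eq_0: "ip n x x = 0 \<longleftrightarrow> (\<forall>i<n. x i = 0)"
  by (auto simp: ip_def sum_nonneg_eq_0_iff)

lemma Cauchy_Schwarz_ip: "\<bar>ip n x y\<bar> \<le> sqrt (ip n x x) * sqrt (ip n y y)"
proof -
  have "(ip n x y)\<^sup>2 \<le> ip n x x * ip n y y"
    using Cauchy_Schwarz_ineq_sum[of x y "{..<n}"] by (simp add: ip_def power2_eq_square)
  then show ?thesis
    by (metis real_sqrt_abs real_sqrt_le_mono real_sqrt_mult)
qed

lemma mv_add: "mv n S (\<lambda>i. x i + y i) = (\<lambda>i. mv n S x i + mv n S y i)"
  by (simp add: mv_def fun_eq_iff distrib_left sum.distrib)

lemma mv_diff: "mv n S (\<lambda>i. x i - y i) = (\<lambda>i. mv n S x i - mv n S y i)"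
  by (simp add: mv_def fun_eq_iff right_diff_distrib sum_subtractf)

lemma mv_scale: "mv n S (\<lambda>i. c * x i) = (\<lambda>i. c * mv n S x i)"
  by (simp add: mv_def fun_eq_iff sum_distrib_left mult.left_commute)

lemma mv_sum: "mv n S (\<lambda>i. \<Sum>k\<in>K. f k i) = (\<lambda>i. \<Sum>k\<in>K. mv n S (f k) i)"
  unfolding mv_def sum_distrib_left by (rule ext, rule sum.swap)

lemma bf_linear:
  "bf n S (\<lambda>i. x i + y i) z = bf n S x z + bf n S y z"
  "bf n S (\<lambda>i. x i - y i) z = bf n S x z - bf n S y z"
  "bf n S (\<lambda>i. c * x i) z = c * bf n S x z"
  "bf n S (\<lambda>i. \<Sum>k\<in>K. f k i) z = (\<Sum>k\<in>K. bf n S (f k) z)"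
  "bf n S z (\<lambda>i. x i + y i) = bf n S z x + bf n S z y"
  "bf n S z (\<lambda>i. x i - y i) = bf n S z x - bf n S z y"
  "bf n S z (\<lambda>i. c * x i) = c * bf n S z x"
  "bf n S z (\<lambda>i. \<Sum>k\<in>K. f k i) = (\<Sum>k\<in>K. bf n S z (f k))"
  by (simp_all add: bf_def mv_add mv_diff mv_scale mv_sum ip_linear)

lemma bf_cong:
  "(\<And>i. i < n \<Longrightarrow> x i = x' i) \<Longrightarrow> (\<And>i. i < n \<Longrightarrow> y i = y' i) \<Longrightarrow> bf n S x y = bf n S x' y'"
  by (simp add: bf_def ip_def mv_def)

lemma bf_alt: "bf n S x y = (\<Sum>i<n. \<Sum>j<n. S i j * (x i * y j))"
  by (simp add: bf_def ip_def mv_def sum_distrib_left ac_simps)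

lemma bf_commute:
  assumes "\<And>i j. i < n \<Longrightarrow> j < n \<Longrightarrow> S i j = S j i"
  shows "bf n S x y = bf n S y x"
proof -
  have "bf n S x y = (\<Sum>j<n. \<Sum>i<n. S i j * (x i * y j))"
    unfolding bf_alt by (rule sum.swap)
  also have "\<dots> = bf n S y x"
    unfolding bf_alt using assms by (intro sum.cong) (auto simp: mult.commute)
  finally show ?thesis .
qed

section \<open>Orthonormal systems, counted by their residuals\<close>

lemma ip_unit_vector: "i < n \<Longrightarrow> ip n (\<lambda>j. if j = i then 1 else 0) x = x i"
  by (simp add: ip_def if_distrib[of "\<lambda>a. a * _"] cong: if_cong)

text \<open>This count replaces dimension arguments: for \<open>m < n\<close> some unit vector is not in the span of the
  \<open>u k\<close>, and for \<open>m = n\<close> all residuals vanish.\<close>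

lemma sum_square_residuals:
  assumes "orthonormal n m u"
  shows "(\<Sum>i<n. \<Sum>j<n. ((if j = i then 1 else 0) - (\<Sum>k<m. u k i * u k j))\<^sup>2) = real n - real m"
proof -
  have row: "(\<Sum>j<n. ((if j = i then 1 else 0) - (\<Sum>k<m. u k i * u k j))\<^sup>2) = 1 - (\<Sum>k<m. u k i * u k i)"
    if "i < n" for i
  proof -
    let ?e = "\<lambda>j. if j = i then 1 else (0::real)"
    let ?p = "\<lambda>j. \<Sum>k<m. u k i * u k j"
    have e: "ip n ?e x = x i" "ip n x ?e = x i" for x
      using ip_unit_vector[OF that, of x] by (simp_all add: ip_commute)
    have pp: "ip n ?p ?p = (\<Sum>k<m. u k i * u k i)"
    proof -
      have "ip n ?p ?p = (\<Sum>k<m. u k i * (\<Sum>l<m. u l i * ip n (u k) (u l)))"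
        by (simp add: ip_linear)
      also have "\<dots> = (\<Sum>k<m. u k i * (\<Sum>l<m. if l = k then u l i else 0))"
        using assms by (intro sum.cong refl arg_cong2[where f="(*)"]) (auto simp: orthonormal_def)
      finally show ?thesis by simp
    qed
    have "(\<Sum>j<n. ((if j = i then 1 else 0) - (\<Sum>k<m. u k i * u k j))\<^sup>2)
       = ip n (\<lambda>j. ?e j - ?p j) (\<lambda>j. ?e j - ?p j)"
      by (simp add: ip_def power2_eq_square)
    also have "\<dots> = 1 - (\<Sum>k<m. u k i * u k i)"
      by (simp add: ip_diff_left ip_diff_right e pp)
    finally show ?thesis .
  qed
  have "(\<Sum>i<n. \<Sum>k<m. u k i * u k i) = (\<Sum>k<m. ip n (u k) (u k))"
    unfolding ip_def by (rule sum.swap)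
  also have "\<dots> = real m" using assms by (simp add: orthonormal_def)
  finally show ?thesis using row by (simp add: sum_subtractf)
qed

lemma orthonormal_complete:
  assumes "orthonormal n n u" "i < n" "j < n"
  shows "(\<Sum>k<n. u k i * u k j) = (if j = i then 1 else 0)"
proof -
  have "(\<Sum>i<n. \<Sum>j<n. ((if j = i then 1 else 0) - (\<Sum>k<n. u k i * u k j))\<^sup>2) = 0"
    using sum_square_residuals[OF assms(1)] by simp
  then have "\<forall>i<n. (\<Sum>j<n. ((if j = i then 1 else 0) - (\<Sum>k<n. u k i * u k j))\<^sup>2) = 0"
    by (subst (asm) sum_nonneg_eq_0_iff) (auto intro: sum_nonneg)
  then have "(\<Sum>j<n. ((if j = i then 1 else 0) - (\<Sum>k<n. u k i * u k j))\<^sup>2) = 0"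
    using assms by blast
  then show ?thesis using assms by (subst (asm) sum_nonneg_eq_0_iff) auto
qed

lemma orthonormal_expansion:
  assumes "orthonormal n n u" "i < n"
  shows "x i = (\<Sum>k<n. ip n (u k) x * u k i)"
proof -
  have "(\<Sum>k<n. ip n (u k) x * u k i) = (\<Sum>j<n. (\<Sum>k<n. u k i * u k j) * x j)"
    unfolding ip_def sum_distrib_right
    by (subst sum.swap) (simp add: ac_simps)
  also have "\<dots> = (\<Sum>j<n. if j = i then x j else 0)"
    using assms by (intro sum.cong refl) (auto simp: orthonormal_complete)
  finally show ?thesis using assms by simp
qed

text \<open>The squared residuals add up to \<open>n - m > 0\<close>, so the residual of some
  coordinate vector is nonzero, and \<open>x\<close> is that residual normalized. Cutting
  \<open>x\<close> off beyond \<open>n\<close> puts it into the compact constraint set used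
  below.\<close>

lemma exists_unit_orthogonal:
  assumes "orthonormal n m u" "m < n"
  obtains x where "ip n x x = 1" "\<And>k. k < m \<Longrightarrow> ip n (u k) x = 0" "\<And>i. i \<ge> n \<Longrightarrow> x i = 0"
proof -
  let ?R = "\<lambda>i j. (if j = i then 1 else (0::real)) - (\<Sum>k<m. u k i * u k j)"
  have "(\<Sum>i<n. \<Sum>j<n. (?R i j)\<^sup>2) \<noteq> 0"
    using sum_square_residuals[OF assms(1)] assms(2) by simp
  then obtain i where i: "i < n" "(\<Sum>j<n. (?R i j)\<^sup>2) \<noteq> 0"
    by (metis (no_types, lifting) lessThan_iff sum.neutral)
  let ?y = "?R i"
  let ?s = "sqrt (ip n ?y ?y)"
  have yy: "ip n ?y ?y > 0"
  proof -
    have "ip n ?y ?y \<noteq> 0" using i(2) by (simp add: ip_def power2_eq_square)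
    then show ?thesis using ip_self_nonneg[of n ?y] by linarith
  qed
  have orth: "ip n (u k) ?y = 0" if "k < m" for k
  proof -
    have 1: "ip n (u k) (\<lambda>j. if j = i then 1 else 0) = u k i"
      using ip_unit_vector[OF i(1), of "u k"] by (simp add: ip_commute)
    have "ip n (u k) (\<lambda>j. \<Sum>l<m. u l i * u l j) = (\<Sum>l<m. u l i * ip n (u k) (u l))"
      by (simp add: ip_linear)
    also have "\<dots> = (\<Sum>l<m. if l = k then u l i else 0)"
      using assms that by (intro sum.cong refl) (auto simp: orthonormal_def)
    also have "\<dots> = u k i" using that by simp
    finally show ?thesis using 1 by (simp add: ip_diff_right)
  qed
  define x where "x = (\<lambda>j. if j < n then (1 / ?s) * ?y j else 0)"
  have x1: "ip n z x = (1 / ?s) * ip n z ?y" for z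
    unfolding ip_scale_right[symmetric] by (rule ip_cong) (auto simp: x_def)
  have "ip n x x = (1 / ?s) * ((1 / ?s) * ip n ?y ?y)"
    using x1[of x] x1[of ?y] by (simp add: ip_commute)
  also have "\<dots> = ip n ?y ?y / (?s * ?s)" by simp
  also have "?s * ?s = ip n ?y ?y" by (intro real_sqrt_mult_self[THEN trans] abs_of_nonneg ip_self_nonneg)
  also have "ip n ?y ?y / ip n ?y ?y = 1" using yy by simp
  finally show ?thesis
    using that[of x] x1 orth by (auto simp: x_def)
qed

section \<open>Eigenvectors by constrained maximization\<close>

lemma compact_unit_constraint:
  "compact {x::nat \<Rightarrow> real. ip n x x = 1 \<and> (\<forall>k<m. ip n (u k) x = 0) \<and> (\<forall>i\<ge>n. x i = 0)}"
    (is "compact ?K")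
proof -
  \<comment> \<open>A unit vector that vanishes beyond \<open>n\<close> has all coordinates in
    [-1, 1], so the constraint set is a closed subset of a product of intervals, which is compact by
    Tychonoff's theorem.\<close>
  let ?B = "PiE UNIV (\<lambda>i::nat. {-1..1::real})"
  have "compactin (product_topology (\<lambda>i::nat. euclidean::real topology) UNIV) ?B"
    by (subst compactin_PiE) auto
  then have B: "compact ?B" by (simp add: euclidean_product_topology)
  have c: "continuous_on UNIV (\<lambda>x::nat\<Rightarrow>real. x i)" for i by simp
  have "closed ({x. ip n x x = 1} \<inter> (\<Inter>k\<in>{..<m}. {x. ip n (u k) x = 0}) \<inter> (\<Inter>i\<in>{n..}. {x. x i = 0}))"
    unfolding ip_def
    by (intro closed_Int closed_INT ballI closed_Collect_eq continuous_intros c)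
  also have "({x. ip n x x = 1} \<inter> (\<Inter>k\<in>{..<m}. {x. ip n (u k) x = 0}) \<inter> (\<Inter>i\<in>{n..}. {x. x i = 0})) = ?K"
    by auto
  finally have cl: "closed ?K" .
  have sub: "?K \<subseteq> ?B"
  proof
    fix x assume x: "x \<in> ?K"
    have "\<bar>x i\<bar> \<le> 1" for i
    proof (cases "i < n")
      case True
      have "x i * x i \<le> ip n x x" unfolding ip_def
        using True by (intro member_le_sum) auto
      then have "(x i)\<^sup>2 \<le> 1" using x by (simp add: power2_eq_square)
      then show ?thesis by (simp add: abs_square_le_1)
    qed (use x in auto)
    then show "x \<in> ?B" by (auto simp: abs_le_iff minus_le_iff)
  qed
  have "compact (?B \<inter> ?K)" using B cl by (rule compact_Int_closed)
  then show ?thesis using sub by (simp add: inf.absorb2)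
qed

lemma linear_coefficient_zero_if_quadratic_nonpos:
  fixes b c :: real
  assumes "\<And>t. 2 * t * b + t\<^sup>2 * c \<le> 0"
  shows "b = 0"
proof (rule ccontr)
  assume "b \<noteq> 0"
  \<comment> \<open>With this \<open>t\<close> the linear term dominates: inserting
    \<open>b = t * (|c| + 1)\<close> turns the form into \<open>t^2 * (2 * (|c| + 1) + c)\<close>,
    which is positive.\<close>
  define t where "t = b / (\<bar>c\<bar> + 1)"
  have t: "t * (\<bar>c\<bar> + 1) = b" by (simp add: t_def add_nonneg_eq_0_iff)
  have "t \<noteq> 0" using t \<open>b \<noteq> 0\<close> by auto
  have "2 * t * b + t\<^sup>2 * c = t\<^sup>2 * (2 * (\<bar>c\<bar> + 1) + c)"
    unfolding t[symmetric] by (simp add: algebra_simps power2_eq_square)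
  moreover have "t\<^sup>2 * (2 * (\<bar>c\<bar> + 1) + c) > 0"
    using \<open>t \<noteq> 0\<close> by (intro mult_pos_pos) auto
  ultimately show False using assms[of t] by linarith
qed

text \<open>\<open>x\<close> maximizes the quadratic form over the unit vectors orthogonal to the
  eigenvectors already found. First-order optimality makes it an eigenvector with the maximum as
  eigenvalue; the last conclusion is maximality, extended by homogeneity.\<close>

lemma spectral_step:
  assumes sym: "\<And>i j. i < n \<Longrightarrow> j < n \<Longrightarrow> S i j = S j i"
    and on: "orthonormal n m u" and "m < n"
    and eig: "\<And>k i. k < m \<Longrightarrow> i < n \<Longrightarrow> mv n S (u k) i = d k * u k i"
  obtains x where "ip n x x = 1" "\<And>k. k < m \<Longrightarrow> ip n (u k) x = 0"
    "\<And>i. i < n \<Longrightarrow> mv n S x i = bf n S x x * x i"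
    "\<And>y. (\<And>k. k < m \<Longrightarrow> ip n (u k) y = 0) \<Longrightarrow> bf n S y y \<le> bf n S x x * ip n y y"
proof -
  have com: "bf n S x y = bf n S y x" for x y
    by (rule bf_commute) (rule sym)
  define K where "K = {x::nat \<Rightarrow> real. ip n x x = 1 \<and> (\<forall>k<m. ip n (u k) x = 0) \<and> (\<forall>i\<ge>n. x i = 0)}"
  have K_iff: "x \<in> K \<longleftrightarrow> ip n x x = 1 \<and> (\<forall>k<m. ip n (u k) x = 0) \<and> (\<forall>i\<ge>n. x i = 0)" for x
    by (simp add: K_def)
  have "K \<noteq> {}"
  proof (rule exists_unit_orthogonal[OF on \<open>m < n\<close>])
    fix x assume "ip n x x = 1" "\<And>k. k < m \<Longrightarrow> ip n (u k) x = 0" "\<And>i. i \<ge> n \<Longrightarrow> x i = 0"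
    then have "x \<in> K" by (simp add: K_iff)
    then show ?thesis by auto
  qed
  moreover have "continuous_on K (\<lambda>x. bf n S x x)"
  proof (rule continuous_on_subset[OF _ subset_UNIV])
    have "continuous_on UNIV (\<lambda>x::nat\<Rightarrow>real. x i)" for i by simp
    then show "continuous_on UNIV (\<lambda>x. bf n S x x)"
      unfolding bf_alt by (intro continuous_intros)
  qed
  moreover have "compact K" unfolding K_def by (rule compact_unit_constraint)
  ultimately obtain x where x: "x \<in> K" and max: "\<And>y. y \<in> K \<Longrightarrow> bf n S y y \<le> bf n S x x"
    using continuous_attains_sup[of K "\<lambda>x. bf n S x x"] by blast
  have xx: "ip n x x = 1" and xo: "\<And>k. k < m \<Longrightarrow> ip n (u k) x = 0" using x by (auto simp: K_iff)
  have max': "bf n S y y \<le> bf n S x x * ip n y y" if yo: "\<And>k. k < m \<Longrightarrow> ip n (u k) y = 0" for y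
  proof (cases "ip n y y = 0")
    case True
    then have "bf n S y y = 0" by (simp add: ip_self_eq_0 bf_alt)
    then show ?thesis using True by simp
  next
    case False
    then have pos: "ip n y y > 0" using ip_self_nonneg[of n y] by linarith
    let ?s = "1 / sqrt (ip n y y)"
    have ss: "?s * ?s * ip n y y = 1" using pos by (simp add: field_simps)
    define z where "z = (\<lambda>j. if j < n then ?s * y j else 0)"
    have z1: "ip n w z = ?s * ip n w y" for w
      unfolding ip_scale_right[symmetric] by (rule ip_cong) (auto simp: z_def)
    have "ip n z z = ?s * ?s * ip n y y"
      using z1[of z] z1[of y] by (simp add: ip_commute)
    then have "z \<in> K" using z1 yo ss by (auto simp: K_iff z_def)
    then have "bf n S z z \<le> bf n S x x" by (rule max)
    moreover have "bf n S z z = bf n S (\<lambda>j. ?s * y j) (\<lambda>j. ?s * y j)"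
      by (rule bf_cong) (auto simp: z_def)
    moreover have "\<dots> = ?s * ?s * bf n S y y"
      by (simp only: bf_linear mult.assoc)
    ultimately have "?s * ?s * bf n S y y * ip n y y \<le> bf n S x x * ip n y y"
      using pos by (metis mult_right_mono order_less_imp_le)
    then show ?thesis using ss by (metis mult.assoc mult.commute mult_1)
  qed
  \<comment> \<open>Moving \<open>x\<close> along an admissible direction \<open>y\<close> cannot
    raise the Rayleigh quotient, so the coefficient of \<open>t\<close> vanishes.\<close>
  have crit: "bf n S x y = 0" if yo: "\<And>k. k < m \<Longrightarrow> ip n (u k) y = 0" and xy: "ip n x y = 0" for y
  proof (rule linear_coefficient_zero_if_quadratic_nonpos)
    fix t :: real
    let ?z = "\<lambda>i. x i + t * y i"
    have "bf n S ?z ?z \<le> bf n S x x * ip n ?z ?z"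
      by (rule max') (simp add: ip_linear xo yo)
    moreover have "ip n ?z ?z = 1 + t\<^sup>2 * ip n y y"
      using xx xy by (simp add: ip_linear ip_commute[of n y x] power2_eq_square)
    moreover have "bf n S ?z ?z = bf n S x x + 2 * t * bf n S x y + t\<^sup>2 * bf n S y y"
      using com[of y x]
      by (simp add: bf_linear power2_eq_square algebra_simps)
    ultimately show "2 * t * bf n S x y + t\<^sup>2 * (bf n S y y - bf n S x x * ip n y y) \<le> 0"
      by (simp add: algebra_simps)
  qed
  let ?c = "bf n S x x"
  \<comment> \<open>The defect \<open>w\<close> of the eigenvalue equation is itself an admissible
    direction orthogonal to \<open>x\<close>. Hence the form of \<open>x\<close> and
    \<open>w\<close> vanishes, and this form equals \<open>ip n w w\<close>.\<close>
  define w where "w = (\<lambda>i. mv n S x i - ?c * x i)"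
  have xw: "ip n x w = 0" unfolding w_def using xx
    by (simp add: ip_linear bf_def)
  have uw: "ip n (u k) w = 0" if "k < m" for k
  proof -
    have "ip n (u k) (mv n S x) = bf n S x (u k)"
      using com[of "u k" x] by (simp add: bf_def)
    also have "\<dots> = ip n x (\<lambda>i. d k * u k i)"
      unfolding bf_def using eig[OF that] by (intro ip_cong) auto
    also have "\<dots> = 0" using xo[OF that] by (simp add: ip_linear ip_commute)
    finally show ?thesis using xo[OF that] by (simp add: w_def ip_linear)
  qed
  have "ip n w w = ip n w (mv n S x) - ?c * ip n w x"
    by (subst (2) w_def) (simp add: ip_diff_right ip_scale_right)
  also have "\<dots> = bf n S x w - ?c * ip n x w"
    using com[of w x] by (simp add: bf_def ip_commute)
  also have "\<dots> = 0" using crit[OF uw xw] xw by simp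
  finally have "\<forall>i<n. w i = 0" by (simp add: ip_self_eq_0)
  then have "\<And>i. i < n \<Longrightarrow> mv n S x i = ?c * x i" by (simp add: w_def)
  then show ?thesis using that[of x] xx xo max' by blast
qed

text \<open>The induction carries a fourth invariant: each \<open>d k\<close> bounds the form on the
  complement of all vectors found so far. It is what puts the next eigenvalue below the earlier
  ones.\<close>

theorem spectral_theorem_sorted:
  assumes sym: "\<And>i j. i < n \<Longrightarrow> j < n \<Longrightarrow> S i j = S j i"
  obtains u d where "orthonormal n n u"
    "\<And>k i. k < n \<Longrightarrow> i < n \<Longrightarrow> mv n S (u k) i = d k * u k i"
    "\<And>k l. k \<le> l \<Longrightarrow> l < n \<Longrightarrow> d l \<le> d k"
proof -
  have "\<exists>u d. orthonormal n m u \<and> (\<forall>k<m. \<forall>i<n. mv n S (u k) i = d k * u k i)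
      \<and> (\<forall>k l. k \<le> l \<longrightarrow> l < m \<longrightarrow> d l \<le> d k)
      \<and> (\<forall>k<m. \<forall>y. (\<forall>l<m. ip n (u l) y = 0) \<longrightarrow> bf n S y y \<le> d k * ip n y y)"
    if "m \<le> n" for m
    using that
  proof (induction m)
    case 0
    show ?case by (simp add: orthonormal_def)
  next
    case (Suc m)
    from Suc.IH[OF Suc_leD[OF Suc.prems]] obtain u d where on: "orthonormal n m u"
      and eig': "\<forall>k<m. \<forall>i<n. mv n S (u k) i = d k * u k i"
      and dec': "\<forall>k l. k \<le> l \<longrightarrow> l < m \<longrightarrow> d l \<le> d k"
      and bd': "\<forall>k<m. \<forall>y. (\<forall>l<m. ip n (u l) y = 0) \<longrightarrow> bf n S y y \<le> d k * ip n y y"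
      by (elim exE conjE)
    have eig: "\<And>k i. k < m \<Longrightarrow> i < n \<Longrightarrow> mv n S (u k) i = d k * u k i"
      and dec: "\<And>k l. k \<le> l \<Longrightarrow> l < m \<Longrightarrow> d l \<le> d k"
      and bd: "\<And>k y. k < m \<Longrightarrow> (\<And>l. l < m \<Longrightarrow> ip n (u l) y = 0) \<Longrightarrow> bf n S y y \<le> d k * ip n y y"
      using eig' dec' bd' by auto
    have "m < n" using Suc.prems by simp
    obtain x where xx: "ip n x x = 1" and xo: "\<And>k. k < m \<Longrightarrow> ip n (u k) x = 0"
      and xe: "\<And>i. i < n \<Longrightarrow> mv n S x i = bf n S x x * x i"
      and mx: "\<And>y. (\<And>k. k < m \<Longrightarrow> ip n (u k) y = 0) \<Longrightarrow> bf n S y y \<le> bf n S x x * ip n y y"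
      by (rule spectral_step[OF sym on \<open>m < n\<close> eig]) blast+
    let ?c = "bf n S x x"
    let ?u = "u(m := x)" and ?d = "d(m := ?c)"
    have cd: "?c \<le> d k" if "k < m" for k
      using bd[OF that xo] xx by simp
    have "orthonormal n (Suc m) ?u"
      using on xx xo ip_commute unfolding orthonormal_def less_Suc_eq by auto
    moreover have "\<forall>k<Suc m. \<forall>i<n. mv n S (?u k) i = ?d k * ?u k i"
      using eig xe by (auto simp: less_Suc_eq)
    moreover have "\<forall>k l. k \<le> l \<longrightarrow> l < Suc m \<longrightarrow> ?d l \<le> ?d k"
      using dec cd by (auto simp: less_Suc_eq)
    moreover have bound: "bf n S y y \<le> ?d k * ip n y y"
      if "k < Suc m" "\<forall>l<Suc m. ip n (?u l) y = 0" for k y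
    proof -
      have "ip n (u l) y = 0" if "l < m" for l
        using \<open>\<forall>l<Suc m. ip n (?u l) y = 0\<close>[rule_format, of l] that by simp
      then show ?thesis using that(1) bd[of k y] mx[of y] by (auto simp: less_Suc_eq)
    qed
    moreover have "\<forall>k<Suc m. \<forall>y. (\<forall>l<Suc m. ip n (?u l) y = 0) \<longrightarrow> bf n S y y \<le> ?d k * ip n y y"
      using bound by simp
    ultimately show ?case by (intro exI[of _ ?u] exI[of _ ?d] conjI)
  qed
  from this[OF order_refl] obtain u d where "orthonormal n n u"
    "\<forall>k<n. \<forall>i<n. mv n S (u k) i = d k * u k i" "\<forall>k l. k \<le> l \<longrightarrow> l < n \<longrightarrow> d l \<le> d k"
    by (elim exE conjE)
  then show ?thesis by (intro that[of u d]) auto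
qed

lemma Parseval:
  assumes "orthonormal n n u"
  shows "ip n x y = (\<Sum>k<n. ip n (u k) x * ip n (u k) y)"
proof -
  have "ip n x y = ip n x (\<lambda>i. \<Sum>k<n. ip n (u k) y * u k i)"
    by (intro ip_cong orthonormal_expansion[OF assms]) auto
  also have "\<dots> = (\<Sum>k<n. ip n (u k) y * ip n x (u k))"
    by (simp only: ip_sum_right ip_scale_right)
  finally show ?thesis
    by (simp add: ip_commute[of n x] mult.commute)
qed

lemma spectral_expansion:
  assumes "orthonormal n n u" "\<And>k i. k < n \<Longrightarrow> i < n \<Longrightarrow> mv n S (u k) i = d k * u k i"
  shows "bf n S x y = (\<Sum>k<n. d k * ip n (u k) x * ip n (u k) y)"
proof -
  have y: "y i = (\<Sum>k<n. ip n (u k) y * u k i)" if "i < n" for i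
    using orthonormal_expansion[OF assms(1) that] .
  have "bf n S x y = bf n S x (\<lambda>i. \<Sum>k<n. ip n (u k) y * u k i)"
    using y by (intro bf_cong) auto
  also have "\<dots> = (\<Sum>k<n. ip n (u k) y * bf n S x (u k))"
    by (simp add: bf_linear)
  also have "\<dots> = (\<Sum>k<n. d k * ip n (u k) x * ip n (u k) y)"
  proof (intro sum.cong refl)
    fix k assume "k \<in> {..<n}"
    then have "bf n S x (u k) = ip n x (\<lambda>i. d k * u k i)"
      unfolding bf_def using assms(2) by (intro ip_cong) auto
    then show "ip n (u k) y * bf n S x (u k) = d k * ip n (u k) x * ip n (u k) y"
      by (simp add: ip_linear ip_commute)
  qed
  finally show ?thesis .
qed

section \<open>Eigenvalue lists and singular values of matrices\<close>

abbreviation entries :: "real mat \<Rightarrow> nat \<Rightarrow> nat \<Rightarrow> real" where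
  "entries S \<equiv> \<lambda>i j. S $$ (i, j)"

lemma symmetric_mat_entries:
  assumes "S \<in> carrier_mat n n" "symmetric_mat S" "i < n" "j < n"
  shows "S $$ (i, j) = S $$ (j, i)"
proof -
  have "transpose_mat S $$ (j, i) = S $$ (i, j)" using assms by simp
  then show ?thesis using assms(2) by (simp add: symmetric_mat_def)
qed

text \<open>Ties the variational eigenvalues to the roots of the characteristic polynomial. With the
  eigenvectors as columns of \<open>U\<close>, \<open>S\<close> is similar to a diagonal matrix, so
  \<open>char_poly S\<close> splits into linear factors whose roots are the
  \<open>d k\<close>.\<close>

lemma nth_eigenvalue_diagonalized:
  assumes S: "S \<in> carrier_mat n n" and on: "orthonormal n n u"
    and eig: "\<And>k i. k < n \<Longrightarrow> i < n \<Longrightarrow> mv n (entries S) (u k) i = d k * u k i"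
    and dec: "\<And>k l. k \<le> l \<Longrightarrow> l < n \<Longrightarrow> d l \<le> d k" and "k < n"
  shows "nth_eigenvalue S (Suc k) = d k"
proof -
  define U where "U = mat n n (\<lambda>(i, k). u k i)"
  define D where "D = mat n n (\<lambda>(i, k). if i = k then d k else 0)"
  have car: "U \<in> carrier_mat n n" "D \<in> carrier_mat n n" by (simp_all add: U_def D_def)
  have UTU: "transpose_mat U * U = 1\<^sub>m n"
  proof (rule eq_matI)
    fix i j assume ij: "i < dim_row (1\<^sub>m n :: real mat)" "j < dim_col (1\<^sub>m n :: real mat)"
    then have "(transpose_mat U * U) $$ (i, j) = ip n (u i) (u j)"
      by (simp add: U_def times_mat_def scalar_prod_def ip_def atLeast0LessThan)
    then show "(transpose_mat U * U) $$ (i, j) = 1\<^sub>m n $$ (i, j)"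
      using on ij by (simp add: orthonormal_def)
  qed (use car in auto)
  then have UUT: "U * transpose_mat U = 1\<^sub>m n"
    using mat_mult_left_right_inverse[of "transpose_mat U" n U] car by simp
  have SU: "S * U = U * D"
  proof (rule eq_matI)
    fix i j assume ij: "i < dim_row (U * D)" "j < dim_col (U * D)"
    then have ij': "i < n" "j < n" using car by auto
    have "(S * U) $$ (i, j) = mv n (entries S) (u j) i"
      using S ij' by (simp add: U_def times_mat_def scalar_prod_def mv_def atLeast0LessThan)
    also have "\<dots> = d j * u j i" using eig ij' by simp
    also have "\<dots> = (\<Sum>k<n. u k i * (if k = j then d j else 0))"
      using ij' by (simp add: if_distrib cong: if_cong)
    also have "\<dots> = (U * D) $$ (i, j)"
      using ij' by (simp add: U_def D_def times_mat_def scalar_prod_def atLeast0LessThan)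
    finally show "(S * U) $$ (i, j) = (U * D) $$ (i, j)" .
  qed (use car S in auto)
  have "S = S * (U * transpose_mat U)" using UUT S by simp
  also have "\<dots> = S * U * transpose_mat U"
    using car S by (intro assoc_mult_mat[symmetric]) auto
  also have "\<dots> = U * D * transpose_mat U" by (simp add: SU)
  finally have "S = U * D * transpose_mat U" .
  then have "similar_mat S D"
    using car S UTU UUT by (intro similar_matI[of _ _ U "transpose_mat U" n]) auto
  then have "char_poly S = char_poly D" by (rule char_poly_similar)
  also have "\<dots> = (\<Prod>a\<leftarrow>diag_mat D. [:- a, 1:])"
    using car by (intro char_poly_upper_triangular) (auto simp: D_def upper_triangular_def)
  also have "diag_mat D = map d [0..<n]"
    by (auto simp: diag_mat_def D_def)
  finally have cp: "char_poly S = (\<Prod>a\<leftarrow>map d [0..<n]. [:- a, 1:])" .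
  have proots_list: "proots (\<Prod>a\<leftarrow>xs. [:- a, 1::real:]) = mset xs" for xs
  proof (induction xs)
    case (Cons a xs)
    have "(\<Prod>a\<leftarrow>xs. [:- a, 1::real:]) \<noteq> 0"
      by auto
    then show ?case
      using Cons by (simp add: proots_mult del: mult_pCons_left)
  qed simp
  \<comment> \<open>The reversed list is ascending already, so sorting leaves it alone, and the
    outer \<open>rev\<close> of \<open>nth_eigenvalue\<close> restores the order of
    \<open>d\<close>. That definition counts from 1, hence \<open>Suc k\<close>.\<close>
  have "proots (char_poly S) = mset (rev (map d [0..<n]))"
    unfolding cp proots_list by simp
  then have "sorted_list_of_multiset (proots (char_poly S)) = sort (rev (map d [0..<n]))"
    by (metis sorted_list_of_multiset_mset)
  also have "\<dots> = rev (map d [0..<n])"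
    by (rule sorted_sort_id) (auto simp: sorted_rev_iff_nth_mono intro!: dec)
  finally show ?thesis using \<open>k < n\<close> by (simp add: nth_eigenvalue_def)
qed

theorem symmetric_mat_spectral:
  assumes "S \<in> carrier_mat n n" "symmetric_mat S"
  obtains u where "orthonormal n n u"
    "\<And>k i. k < n \<Longrightarrow> i < n \<Longrightarrow> mv n (entries S) (u k) i = nth_eigenvalue S (Suc k) * u k i"
    "\<And>k l. k \<le> l \<Longrightarrow> l < n \<Longrightarrow> nth_eigenvalue S (Suc l) \<le> nth_eigenvalue S (Suc k)"
proof -
  have sym: "\<And>i j. i < n \<Longrightarrow> j < n \<Longrightarrow> entries S i j = entries S j i"
    using symmetric_mat_entries[OF assms] .
  show ?thesis
  proof (rule spectral_theorem_sorted[OF sym])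
    fix u d assume *: "orthonormal n n u"
      "\<And>k i. k < n \<Longrightarrow> i < n \<Longrightarrow> mv n (entries S) (u k) i = d k * u k i"
      "\<And>k l. k \<le> l \<Longrightarrow> l < n \<Longrightarrow> d l \<le> d k"
    then have "\<And>k. k < n \<Longrightarrow> nth_eigenvalue S (Suc k) = d k"
      by (intro nth_eigenvalue_diagonalized[OF assms(1)]) 
    with * show ?thesis by (intro that[of u]) auto
  qed
qed

lemma orthonormal_ip: "orthonormal n m u \<Longrightarrow> k < m \<Longrightarrow> l < m \<Longrightarrow> ip n (u k) (u l) = (if k = l then 1 else 0)"
  by (simp add: orthonormal_def)

lemma symmetric_mat_top_eigenvalue:
  assumes "S \<in> carrier_mat n n" "symmetric_mat S" "0 < n"
  shows "bf n (entries S) x x \<le> nth_eigenvalue S 1 * ip n x x"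
    and "\<exists>v. ip n v v = 1 \<and> bf n (entries S) v v = nth_eigenvalue S 1"
proof -
  have "(\<forall>x. bf n (entries S) x x \<le> nth_eigenvalue S 1 * ip n x x) \<and>
    (\<exists>v. ip n v v = 1 \<and> bf n (entries S) v v = nth_eigenvalue S 1)"
  proof (rule symmetric_mat_spectral[OF assms(1,2)])
    fix u assume on: "orthonormal n n u"
      and eig: "\<And>k i. k < n \<Longrightarrow> i < n \<Longrightarrow> mv n (entries S) (u k) i = nth_eigenvalue S (Suc k) * u k i"
      and dec: "\<And>k l. k \<le> l \<Longrightarrow> l < n \<Longrightarrow> nth_eigenvalue S (Suc l) \<le> nth_eigenvalue S (Suc k)"
    have "bf n (entries S) x x \<le> nth_eigenvalue S 1 * ip n x x" for x
    proof -
      have "bf n (entries S) x x = (\<Sum>k<n. nth_eigenvalue S (Suc k) * (ip n (u k) x * ip n (u k) x))"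
        by (simp add: spectral_expansion[OF on eig] mult.assoc)
      also have "\<dots> \<le> (\<Sum>k<n. nth_eigenvalue S 1 * (ip n (u k) x * ip n (u k) x))"
        using dec[of 0] by (intro sum_mono mult_right_mono) auto
      finally show ?thesis
        by (simp add: Parseval[OF on, of x x] sum_distrib_left)
    qed
    moreover have "bf n (entries S) (u 0) (u 0) = ip n (u 0) (\<lambda>i. nth_eigenvalue S 1 * u 0 i)"
      unfolding bf_def using eig[OF assms(3)] by (intro ip_cong) auto
    ultimately show ?thesis
      using orthonormal_ip[OF on assms(3) assms(3)] by (auto simp: ip_scale_right intro!: exI[of _ "u 0"])
  qed
  then show "bf n (entries S) x x \<le> nth_eigenvalue S 1 * ip n x x"
    "\<exists>v. ip n v v = 1 \<and> bf n (entries S) v v = nth_eigenvalue S 1" by auto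
qed

text \<open>An eigenvector of \<open>S\<close> is one of \<open>transpose_mat S * S\<close> for the
  squared eigenvalue, which the largest eigenvalue of that matrix bounds.\<close>

lemma abs_nth_eigenvalue_le_singular:
  assumes S: "S \<in> carrier_mat n n" "symmetric_mat S" and "k < n"
  shows "\<bar>nth_eigenvalue S (Suc k)\<bar> \<le> nth_singular_value S 1"
proof (rule symmetric_mat_spectral[OF S])
  fix u assume on: "orthonormal n n u"
    and eig: "\<And>k i. k < n \<Longrightarrow> i < n \<Longrightarrow> mv n (entries S) (u k) i = nth_eigenvalue S (Suc k) * u k i"
  let ?T = "transpose_mat S * S" and ?d = "nth_eigenvalue S (Suc k)"
  have T: "?T \<in> carrier_mat n n" "symmetric_mat ?T"
    using S(1) by (auto simp: symmetric_mat_def transpose_mult[of "transpose_mat S" n n S n])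
  have TE: "?T $$ (i, j) = (\<Sum>l<n. S $$ (i, l) * S $$ (l, j))" if "i < n" "j < n" for i j
    using S(1) that symmetric_mat_entries[OF S]
    by (auto simp: times_mat_def scalar_prod_def atLeast0LessThan intro!: sum.cong)
  have mvT: "mv n (entries ?T) x i = mv n (entries S) (mv n (entries S) x) i" if "i < n" for x i
  proof -
    have "mv n (entries ?T) x i = (\<Sum>j<n. \<Sum>l<n. S $$ (i, l) * S $$ (l, j) * x j)"
      using that by (simp add: mv_def TE sum_distrib_right)
    also have "\<dots> = (\<Sum>l<n. \<Sum>j<n. S $$ (i, l) * S $$ (l, j) * x j)" by (rule sum.swap)
    finally show ?thesis by (simp add: mv_def sum_distrib_left mult.assoc)
  qed
  have "mv n (entries ?T) (u k) i = ?d\<^sup>2 * u k i" if "i < n" for i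
  proof -
    have "mv n (entries ?T) (u k) i = mv n (entries S) (\<lambda>i. ?d * u k i) i"
      unfolding mvT[OF that] using eig[OF \<open>k < n\<close>] by (simp add: mv_def)
    then show ?thesis using eig[OF \<open>k < n\<close> that] by (simp add: mv_scale power2_eq_square)
  qed
  then have "bf n (entries ?T) (u k) (u k) = ip n (u k) (\<lambda>i. ?d\<^sup>2 * u k i)"
    unfolding bf_def by (intro ip_cong) auto
  then have "?d\<^sup>2 \<le> nth_eigenvalue ?T 1"
    using symmetric_mat_top_eigenvalue(1)[OF T, of "u k"] \<open>k < n\<close> orthonormal_ip[OF on \<open>k < n\<close> \<open>k < n\<close>]
    by (simp add: ip_scale_right)
  then show ?thesis
    unfolding nth_singular_value_def by (intro real_le_rsqrt) simp
qed

section \<open>Operator norm and perturbation of the top eigenvalue\<close>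

text \<open>In eigenbasis coordinates this is Cauchy-Schwarz with weights \<open>d k\<close>;
  Parseval turns the coordinate sums back into norms.\<close>

lemma bf_le_spectral_radius:
  assumes on: "orthonormal n n u" and eig: "\<And>k i. k < n \<Longrightarrow> i < n \<Longrightarrow> mv n S (u k) i = d k * u k i"
    and D: "\<And>k. k < n \<Longrightarrow> \<bar>d k\<bar> \<le> D" and "0 \<le> D"
  shows "\<bar>bf n S x y\<bar> \<le> D * (sqrt (ip n x x) * sqrt (ip n y y))"
proof -
  let ?a = "\<lambda>k. \<bar>ip n (u k) x\<bar>" and ?b = "\<lambda>k. \<bar>ip n (u k) y\<bar>"
  have "bf n S x y = (\<Sum>k<n. d k * ip n (u k) x * ip n (u k) y)"
    by (rule spectral_expansion[OF on eig])
  then have "\<bar>bf n S x y\<bar> \<le> (\<Sum>k<n. \<bar>d k * ip n (u k) x * ip n (u k) y\<bar>)"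
    by (metis sum_abs)
  also have "\<dots> \<le> (\<Sum>k<n. D * (?a k * ?b k))"
    using D by (intro sum_mono) (auto simp: abs_mult mult.assoc intro!: mult_right_mono)
  also have "\<dots> = D * ip n ?a ?b" by (simp add: ip_def sum_distrib_left)
  also have "\<dots> \<le> D * (sqrt (ip n ?a ?a) * sqrt (ip n ?b ?b))"
    using Cauchy_Schwarz_ip[of n ?a ?b] \<open>0 \<le> D\<close> by (intro mult_left_mono) auto
  also have "ip n ?a ?a = ip n x x"
    unfolding Parseval[OF on, of x x] by (simp add: ip_def)
  also have "ip n ?b ?b = ip n y y"
    unfolding Parseval[OF on, of y y] by (simp add: ip_def)
  finally show ?thesis .
qed

text \<open>Scaled by \<open>1 / (4 * sqrt n)\<close> these integer points lie in the unit ball. The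
  box and the extensional function space make finiteness immediate; integers with
  \<open>k^2 <= 16 * n\<close> lie in the box because \<open>|k| <= k^2\<close>.\<close>

definition lattice_net :: "nat \<Rightarrow> (nat \<Rightarrow> int) set" where
  "lattice_net n = {m \<in> {..<n} \<rightarrow>\<^sub>E {- int (16 * n)..int (16 * n)}. (\<Sum>i<n. (m i)\<^sup>2) \<le> int (16 * n)}"

lemma abs_le_square_int: "\<bar>k\<bar> \<le> k\<^sup>2" for k :: int
  using mult_left_mono[of 1 "\<bar>k\<bar>" "\<bar>k\<bar>"]
  by (cases "k = 0") (auto simp: power2_eq_square abs_mult[symmetric])

lemma finite_lattice_net: "finite (lattice_net n)"
  by (rule finite_subset[of _ "{..<n} \<rightarrow>\<^sub>E {- int (16 * n)..int (16 * n)}"])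
    (auto simp: lattice_net_def intro: finite_PiE)

text \<open>Give an integer vector \<open>m\<close> the weight with factors
  \<open>(1/2)^|m i|\<close>. On the net it is at least \<open>2^(-16 n)\<close>, because the
  \<open>|m i|\<close> sum to at most \<open>16 n\<close>; over the whole box the weights factor
  into \<open>n\<close> geometric sums, each at most 4. So there are at most
  \<open>4^n * 2^(16 n) = 2^(18 n)\<close> points.\<close>

lemma card_lattice_net: "real (card (lattice_net n)) \<le> exp (18 * real n)"
proof -
  let ?h = "\<lambda>k::int. (1 / 2 :: real) ^ nat \<bar>k\<bar>"
  let ?B = "{- int (16 * n)..int (16 * n)}"
  have sum_le: "(\<Sum>k\<in>{- int N..int N}. ?h k) \<le> 3 - 2 * (1 / 2) ^ N" for N
  proof (induction N)
    case (Suc N)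
    have "{- int (Suc N)..int (Suc N)} = insert (- int (Suc N)) (insert (int (Suc N)) {- int N..int N})"
      by auto
    then have "(\<Sum>k\<in>{- int (Suc N)..int (Suc N)}. ?h k) = ?h (- int (Suc N)) + (?h (int (Suc N)) + (\<Sum>k\<in>{- int N..int N}. ?h k))"
      by simp
    also have "\<dots> = 2 * (1 / 2) ^ Suc N + (\<Sum>k\<in>{- int N..int N}. ?h k)"
      by (simp del: of_nat_Suc power_Suc)
    finally show ?case using Suc by simp
  qed simp
  have "real (card (lattice_net n)) * (1 / 2) ^ (16 * n) = (\<Sum>m\<in>lattice_net n. (1 / 2) ^ (16 * n))"
    by simp
  also have "\<dots> \<le> (\<Sum>m\<in>lattice_net n. \<Prod>i<n. ?h (m i))"
  proof (rule sum_mono)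
    fix m assume m: "m \<in> lattice_net n"
    have "(\<Sum>i<n. \<bar>m i\<bar>) \<le> (\<Sum>i<n. (m i)\<^sup>2)" by (intro sum_mono abs_le_square_int)
    also have "\<dots> \<le> int (16 * n)" using m by (simp add: lattice_net_def)
    finally have "int (\<Sum>i<n. nat \<bar>m i\<bar>) \<le> int (16 * n)" by simp
    then have "(\<Sum>i<n. nat \<bar>m i\<bar>) \<le> 16 * n" by (simp only: of_nat_le_iff)
    then have "(1 / 2 :: real) ^ (16 * n) \<le> (1 / 2) ^ (\<Sum>i<n. nat \<bar>m i\<bar>)"
      by (intro power_decreasing) auto
    then show "(1 / 2 :: real) ^ (16 * n) \<le> (\<Prod>i<n. ?h (m i))" by (simp add: power_sum)
  qed
  also have "\<dots> \<le> (\<Sum>m\<in>{..<n} \<rightarrow>\<^sub>E ?B. \<Prod>i<n. ?h (m i))"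
  proof (rule sum_mono2)
    show "finite ({..<n} \<rightarrow>\<^sub>E ?B)" by (rule finite_PiE) auto
    show "lattice_net n \<subseteq> {..<n} \<rightarrow>\<^sub>E ?B" unfolding lattice_net_def by (rule Collect_restrict)
    show "0 \<le> (\<Prod>i<n. ?h (m i))" for m by (rule prod_nonneg) simp
  qed
  also have "\<dots> = (\<Prod>i<n. \<Sum>k\<in>?B. ?h k)"
    by (rule prod_sum_PiE[symmetric]) auto
  also have "\<dots> \<le> (\<Prod>i<n. 4)"
  proof (intro prod_mono conjI)
    have "0 \<le> (1 / 2 :: real) ^ (16 * n)" by simp
    then show "(\<Sum>k\<in>?B. ?h k) \<le> 4" using sum_le[of "16 * n"] by linarith
  qed (auto intro: sum_nonneg)
  finally have *: "real (card (lattice_net n)) * (1 / 2) ^ (16 * n) \<le> 4 ^ n" by simp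
  have "real (card (lattice_net n)) = real (card (lattice_net n)) * (1 / 2) ^ (16 * n) * 2 ^ (16 * n)"
    by (simp add: power_one_over)
  also have "\<dots> \<le> 4 ^ n * 2 ^ (16 * n)" using * by (rule mult_right_mono) simp
  also have "\<dots> = (4 * 2 ^ 16) ^ n" by (simp only: power_mult power_mult_distrib)
  also have "\<dots> = (2 ^ 18) ^ n" by simp
  also have "\<dots> \<le> (exp 18) ^ n"
  proof (rule power_mono)
    have "(2::real) ^ 18 \<le> exp 1 ^ 18" using exp_ge_add_one_self[of 1] by (intro power_mono) auto
    then show "(2::real) ^ 18 \<le> exp 18" using exp_of_nat_mult[of 18 "1::real"] by simp
  qed simp
  also have "\<dots> = exp (18 * real n)" using exp_of_nat_mult[of n "18::real"] by (simp add: mult.commute)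
  finally show ?thesis .
qed

text \<open>Each coordinate of \<open>4 * sqrt n * v\<close> is moved by at most 1, so after
  rescaling the squared error is at most \<open>n / (16 * n)\<close>.\<close>

lemma lattice_net_approximates_unit:
  assumes v: "ip n v v = 1"
  obtains m where "m \<in> lattice_net n"
    "(\<Sum>i<n. (v i - real_of_int (m i) / (4 * sqrt n))\<^sup>2) \<le> 1 / 16"
    "(\<Sum>i<n. (real_of_int (m i) / (4 * sqrt n))\<^sup>2) \<le> 1"
proof -
  have n: "n > 0" using v by (cases n) (auto simp: ip_def)
  let ?s = "4 * sqrt (real n)"
  have s: "?s > 0" "?s\<^sup>2 = 16 * real n" using n by (auto simp: power_mult_distrib)
  define m :: "nat \<Rightarrow> int" where
    \<comment> \<open>Rounding towards zero keeps \<open>m / ?s\<close> in the unit ball.\<close>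
    "m = (\<lambda>i\<in>{..<n}. if v i \<ge> 0 then \<lfloor>?s * v i\<rfloor> else \<lceil>?s * v i\<rceil>)"
  have m: "\<bar>real_of_int (m i)\<bar> \<le> \<bar>?s * v i\<bar> \<and> \<bar>?s * v i - m i\<bar> \<le> 1" if "i < n" for i
  proof (cases "v i \<ge> 0")
    case True
    then have "0 \<le> ?s * v i" using s by simp
    then have "0 \<le> \<lfloor>?s * v i\<rfloor>" by simp
    then show ?thesis using that True \<open>0 \<le> ?s * v i\<close>
      by (simp add: m_def) linarith
  next
    case False
    then have "?s * v i < 0" using s by (intro mult_pos_neg) auto
    then have "\<lceil>?s * v i\<rceil> \<le> 0" by simp
    then show ?thesis using that False \<open>?s * v i < 0\<close>
      by (simp add: m_def) linarith
  qed
  have msq: "(real_of_int (m i))\<^sup>2 \<le> ?s\<^sup>2 * (v i)\<^sup>2" if "i < n" for i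
  proof -
    have "(real_of_int (m i))\<^sup>2 \<le> (?s * v i)\<^sup>2"
      using m[OF that] by (simp add: abs_le_square_iff)
    then show ?thesis by (simp only: power_mult_distrib)
  qed
  have "(\<Sum>i<n. (real_of_int (m i))\<^sup>2) \<le> (\<Sum>i<n. ?s\<^sup>2 * (v i)\<^sup>2)"
    using msq by (intro sum_mono) auto
  also have "\<dots> = ?s\<^sup>2" using v unfolding sum_distrib_left[symmetric]
    by (simp add: ip_def power2_eq_square)
  finally have sq: "(\<Sum>i<n. (real_of_int (m i))\<^sup>2) \<le> ?s\<^sup>2" .
  then have "real_of_int (\<Sum>i<n. (m i)\<^sup>2) \<le> real_of_int (int (16 * n))"
    using s by simp
  then have l2: "(\<Sum>i<n. (m i)\<^sup>2) \<le> int (16 * n)" by (simp only: of_int_le_iff)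
  have "\<bar>m i\<bar> \<le> int (16 * n)" if "i < n" for i
  proof -
    have "\<bar>m i\<bar> \<le> (m i)\<^sup>2" by (rule abs_le_square_int)
    also have "\<dots> \<le> (\<Sum>i<n. (m i)\<^sup>2)" using that by (intro member_le_sum) auto
    finally show ?thesis using l2 by linarith
  qed
  then have "m \<in> lattice_net n"
    using l2 by (auto simp: lattice_net_def m_def abs_le_iff PiE_iff minus_le_iff)
  moreover have "(\<Sum>i<n. (v i - real_of_int (m i) / ?s)\<^sup>2) \<le> (\<Sum>i<n. 1 / ?s\<^sup>2)"
  proof (rule sum_mono)
    fix i assume "i \<in> {..<n}"
    then have "(?s * v i - m i)\<^sup>2 \<le> 1" using m[of i] by (simp add: abs_square_le_1)
    moreover have "v i - real_of_int (m i) / ?s = (?s * v i - m i) / ?s" using s by (simp add: field_simps)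
    ultimately show "(v i - real_of_int (m i) / ?s)\<^sup>2 \<le> 1 / ?s\<^sup>2"
      by (simp only: power_divide) (intro divide_right_mono, auto)
  qed
  then have "(\<Sum>i<n. (v i - real_of_int (m i) / ?s)\<^sup>2) \<le> 1 / 16" using n s by simp
  moreover have "(\<Sum>i<n. (real_of_int (m i) / ?s)\<^sup>2) \<le> 1"
    using sq s by (simp only: power_divide sum_divide_distrib[symmetric]) (simp add: divide_le_eq n)
  ultimately show ?thesis using that by blast
qed

text \<open>Let \<open>v\<close> be a unit eigenvector for an eigenvalue of largest modulus
  \<open>D\<close>, and \<open>z\<close> the scaled net point near it. Passing from \<open>v\<close>
  to \<open>z\<close> in each argument costs at most \<open>D / 4\<close>, so
  \<open>D <= D / 2 + t\<close>.\<close>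

theorem bf_le_of_lattice_net:
  assumes sym: "\<And>i j. i < n \<Longrightarrow> j < n \<Longrightarrow> S i j = S j i" and "0 \<le> t"
    and net: "\<And>m. m \<in> lattice_net n \<Longrightarrow> \<bar>bf n S (\<lambda>i. real_of_int (m i)) (\<lambda>i. real_of_int (m i))\<bar> \<le> 16 * real n * t"
  shows "\<bar>bf n S x y\<bar> \<le> 2 * t * (sqrt (ip n x x) * sqrt (ip n y y))"
proof (rule spectral_theorem_sorted[OF sym])
  fix u d assume on: "orthonormal n n u"
    and eig: "\<And>k i. k < n \<Longrightarrow> i < n \<Longrightarrow> mv n S (u k) i = d k * u k i"
  have "\<bar>d k\<bar> \<le> 2 * t" if "k < n" for k
  proof -
    have fin: "finite ((\<lambda>k. \<bar>d k\<bar>) ` {..<n})" and ne: "(\<lambda>k. \<bar>d k\<bar>) ` {..<n} \<noteq> {}"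
      using that by auto
    obtain K where K: "K < n" "Max ((\<lambda>k. \<bar>d k\<bar>) ` {..<n}) = \<bar>d K\<bar>"
      using Max_in[OF fin ne] by auto
    have max: "\<bar>d l\<bar> \<le> \<bar>d K\<bar>" if "l < n" for l
      using that fin by (auto simp: K(2)[symmetric])
    let ?v = "u K" and ?s = "4 * sqrt (real n)"
    have v: "ip n ?v ?v = 1" using orthonormal_ip[OF on K(1) K(1)] by simp
    obtain m where m: "m \<in> lattice_net n"
      and w: "(\<Sum>i<n. (?v i - real_of_int (m i) / ?s)\<^sup>2) \<le> 1 / 16"
      and z: "(\<Sum>i<n. (real_of_int (m i) / ?s)\<^sup>2) \<le> 1"
      by (rule lattice_net_approximates_unit[OF v])
    let ?m = "\<lambda>i. real_of_int (m i)"
    let ?z = "\<lambda>i. (1 / ?s) * ?m i" let ?w = "\<lambda>i. ?v i - ?z i"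
    have s2: "(1 / ?s) * (1 / ?s) = 1 / (16 * real n)" by simp
    have ww: "sqrt (ip n ?w ?w) \<le> 1 / 4"
      using w by (intro real_le_lsqrt) (simp_all add: ip_def power2_eq_square)
    have zz: "sqrt (ip n ?z ?z) \<le> 1"
      using z by (simp add: ip_def power2_eq_square)
    have "bf n S ?v ?v = ip n ?v (\<lambda>i. d K * ?v i)"
      unfolding bf_def using eig[OF K(1)] by (intro ip_cong) auto
    then have "d K = bf n S ?v ?v" using v by (simp add: ip_scale_right)
    \<comment> \<open>\<open>v = w + z\<close> is inserted first on the left, then on the right, so
      the two error terms pair \<open>w\<close> with \<open>v\<close> and with \<open>z\<close>,
      both in the unit ball.\<close>
    also have "\<dots> = bf n S ?w ?v + bf n S ?z ?w + bf n S ?z ?z"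
      by (simp add: bf_linear(2,6))
    finally have "\<bar>d K\<bar> \<le> \<bar>bf n S ?w ?v\<bar> + \<bar>bf n S ?z ?w\<bar> + \<bar>bf n S ?z ?z\<bar>" by linarith
    also have "\<bar>bf n S ?w ?v\<bar> \<le> \<bar>d K\<bar> * (1 / 4)"
    proof -
      have "\<bar>bf n S ?w ?v\<bar> \<le> \<bar>d K\<bar> * (sqrt (ip n ?w ?w) * sqrt (ip n ?v ?v))"
        by (rule bf_le_spectral_radius[OF on eig max]) auto
      also have "\<dots> \<le> \<bar>d K\<bar> * (1 / 4)"
        unfolding v using ww by (intro mult_left_mono) auto
      finally show ?thesis .
    qed
    also have "\<bar>bf n S ?z ?w\<bar> \<le> \<bar>d K\<bar> * (1 / 4)"
    proof -
      have "\<bar>bf n S ?z ?w\<bar> \<le> \<bar>d K\<bar> * (sqrt (ip n ?z ?z) * sqrt (ip n ?w ?w))"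
        by (rule bf_le_spectral_radius[OF on eig max]) auto
      also have "\<dots> \<le> \<bar>d K\<bar> * (1 * (1 / 4))"
        using ww zz by (intro mult_left_mono mult_mono) auto
      finally show ?thesis by simp
    qed
    also have "bf n S ?z ?z = (1 / ?s) * (1 / ?s) * bf n S ?m ?m"
      by (simp only: bf_linear mult.assoc)
    also have "\<bar>\<dots>\<bar> \<le> t"
      using net[OF m] K(1) unfolding s2 by (simp add: abs_mult divide_le_eq mult.commute)
    finally have "\<bar>d K\<bar> \<le> 2 * t" by simp
    then show ?thesis using max[OF that] by linarith
  qed
  then show ?thesis using \<open>0 \<le> t\<close> by (intro bf_le_spectral_radius[OF on eig]) auto
qed

text \<open>With \<open>Q\<close> the squared length of \<open>q\<close>, the gap costs
  \<open>\<tau> * Q\<close>. By \<open>2 * W <= \<tau>\<close>, half of it pays for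
  \<open>W * Q\<close>; the other half is set against the cross term \<open>2 * W * sqrt Q\<close>,
  and completing the square leaves \<open>2 * W^2 / \<tau>\<close>.\<close>

lemma bf_perturbed_le:
  assumes on: "orthonormal n n u" and eig: "\<And>k i. k < n \<Longrightarrow> i < n \<Longrightarrow> mv n S (u k) i = d k * u k i"
    and symE: "\<And>i j. i < n \<Longrightarrow> j < n \<Longrightarrow> R i j = R j i"
    and top: "\<And>k. k < r \<Longrightarrow> d k \<le> d 0" and low: "\<And>k. r \<le> k \<Longrightarrow> k < n \<Longrightarrow> d k \<le> d 0 - \<tau>"
    and "r \<le> n" and W: "\<And>x y. \<bar>bf n R x y\<bar> \<le> W * (sqrt (ip n x x) * sqrt (ip n y y))"
    and "0 \<le> W" "2 * W \<le> \<tau>" "0 < \<tau>"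
    and F: "(\<Sum>k<r. \<Sum>l<r. (bf n R (u k) (u l))\<^sup>2) \<le> f\<^sup>2" and "0 \<le> f"
    and v: "ip n v v = 1"
  shows "bf n S v v + bf n R v v \<le> d 0 + f + 2 * W\<^sup>2 / \<tau>"
proof -
  let ?a = "\<lambda>k. ip n (u k) v"
  let ?P = "\<Sum>k<r. ?a k * ?a k" and ?Q = "\<Sum>k=r..<n. ?a k * ?a k"
  have split: "(\<Sum>k<n. g k) = (\<Sum>k<r. g k) + (\<Sum>k=r..<n. g k)" for g :: "nat \<Rightarrow> real"
    using \<open>r \<le> n\<close> by (metis atLeast0LessThan le0 sum.atLeastLessThan_concat)
  have P0: "?P \<ge> 0" and Q0: "?Q \<ge> 0" by (auto intro: sum_nonneg)
  have PQ: "?P + ?Q = 1" using Parseval[OF on, of v v] split[of "\<lambda>k. ?a k * ?a k"] v by simp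
  have "bf n S v v = (\<Sum>k<r. d k * (?a k * ?a k)) + (\<Sum>k=r..<n. d k * (?a k * ?a k))"
    using split[of "\<lambda>k. d k * (?a k * ?a k)"] by (simp add: spectral_expansion[OF on eig] mult.assoc)
  also have "\<dots> \<le> (\<Sum>k<r. d 0 * (?a k * ?a k)) + (\<Sum>k=r..<n. (d 0 - \<tau>) * (?a k * ?a k))"
    using top low by (intro add_mono sum_mono mult_right_mono) auto
  also have "\<dots> = d 0 * ?P + (d 0 - \<tau>) * ?Q" by (simp add: sum_distrib_left)
  also have "\<dots> = d 0 * (?P + ?Q) - \<tau> * ?Q" by (simp only: distrib_left left_diff_distrib)
  finally have SV: "bf n S v v \<le> d 0 - \<tau> * ?Q" by (simp add: PQ)
  let ?p = "\<lambda>i. \<Sum>k<r. ?a k * u k i" let ?q = "\<lambda>i. v i - ?p i"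
  have up: "ip n (u k) ?p = (if k < r then ?a k else 0)" if "k < n" for k
  proof -
    have "ip n (u k) ?p = (\<Sum>l<r. ?a l * ip n (u k) (u l))"
      by (simp only: ip_sum_right ip_scale_right)
    also have "\<dots> = (\<Sum>l<r. if l = k then ?a l else 0)"
      using that \<open>r \<le> n\<close> by (intro sum.cong refl) (auto simp: orthonormal_ip[OF on])
    finally show ?thesis by auto
  qed
  have pp: "ip n ?p ?p = ?P"
    unfolding Parseval[OF on, of ?p ?p] split using \<open>r \<le> n\<close> by (simp add: up)
  have qq: "ip n ?q ?q = ?Q"
    unfolding Parseval[OF on, of ?q ?q] split using \<open>r \<le> n\<close> by (simp add: up ip_diff_right)
  have com: "bf n R x y = bf n R y x" for x y by (rule bf_commute) (rule symE)
  have "bf n R v v = bf n R (\<lambda>i. ?p i + ?q i) (\<lambda>i. ?p i + ?q i)" by simp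
  also have "\<dots> = bf n R ?p ?p + 2 * bf n R ?p ?q + bf n R ?q ?q"
    unfolding bf_linear(1,5) using com[of ?q ?p] by simp
  finally have RV: "bf n R v v = bf n R ?p ?p + 2 * bf n R ?p ?q + bf n R ?q ?q" .
  \<comment> \<open>As a sum over pairs \<open>(k, l)\<close>, the form at \<open>?p\<close> pairs
    the products of coefficients, of total square \<open>?P^2\<close>, with the entries of the
    compression of \<open>R\<close>, of Frobenius norm at most \<open>f\<close>.\<close>
  have "bf n R ?p ?p = (\<Sum>k<r. \<Sum>l<r. (?a k * ?a l) * bf n R (u k) (u l))"
    by (simp only: bf_linear(4,8,3,7) sum_distrib_left mult.assoc)
  also have "\<dots> = (\<Sum>(k,l)\<in>{..<r}\<times>{..<r}. (?a k * ?a l) * bf n R (u k) (u l))"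
    by (simp add: sum.cartesian_product)
  finally have "(bf n R ?p ?p)\<^sup>2 =
      (\<Sum>z\<in>{..<r}\<times>{..<r}. (case z of (k, l) \<Rightarrow> ?a k * ?a l) * (case z of (k, l) \<Rightarrow> bf n R (u k) (u l)))\<^sup>2"
    by (simp add: case_prod_beta)
  also have "\<dots> \<le> (\<Sum>z\<in>{..<r}\<times>{..<r}. (case z of (k, l) \<Rightarrow> ?a k * ?a l)\<^sup>2)
     * (\<Sum>z\<in>{..<r}\<times>{..<r}. (case z of (k, l) \<Rightarrow> bf n R (u k) (u l))\<^sup>2)"
    by (rule Cauchy_Schwarz_ineq_sum)
  also have "\<dots> = (\<Sum>k<r. \<Sum>l<r. (?a k * ?a l)\<^sup>2) * (\<Sum>k<r. \<Sum>l<r. (bf n R (u k) (u l))\<^sup>2)"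
    by (simp add: sum.cartesian_product case_prod_beta)
  also have "(\<Sum>k<r. \<Sum>l<r. (?a k * ?a l)\<^sup>2) = ?P * ?P"
    by (simp add: sum_product power2_eq_square ac_simps)
  also have "?P * ?P * (\<Sum>k<r. \<Sum>l<r. (bf n R (u k) (u l))\<^sup>2) \<le> ?P * ?P * f\<^sup>2"
    using F P0 by (intro mult_left_mono) auto
  also have "\<dots> = (?P * f)\<^sup>2" by (simp add: power2_eq_square)
  finally have "bf n R ?p ?p \<le> ?P * f"
    using P0 \<open>0 \<le> f\<close> by (intro power2_le_imp_le[of "bf n R ?p ?p"]) auto
  also have "\<dots> \<le> 1 * f" using PQ Q0 \<open>0 \<le> f\<close> by (intro mult_right_mono) auto
  finally have Rpp: "bf n R ?p ?p \<le> f" by simp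
  have "bf n R ?p ?q \<le> W * (sqrt ?P * sqrt ?Q)" using W[of ?p ?q] unfolding pp qq by linarith
  also have "\<dots> \<le> W * (1 * sqrt ?Q)"
    using PQ Q0 \<open>0 \<le> W\<close> by (intro mult_left_mono mult_right_mono) auto
  finally have Rpq: "bf n R ?p ?q \<le> W * sqrt ?Q" by simp
  have Rqq: "bf n R ?q ?q \<le> W * ?Q" using W[of ?q ?q] Q0 unfolding qq by simp
  have "2 * (W * sqrt ?Q) + W * ?Q - \<tau> * ?Q \<le> 2 * W * sqrt ?Q - \<tau> / 2 * (sqrt ?Q)\<^sup>2"
    using mult_right_mono[OF \<open>2 * W \<le> \<tau>\<close> Q0] Q0 by (simp add: algebra_simps)
  also have "\<dots> \<le> 2 * W\<^sup>2 / \<tau>"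
  proof -
    \<comment> \<open>The square vanishes at \<open>sqrt ?Q = 2 * W / \<tau>\<close>, where the
      quadratic to be bounded is largest.\<close>
    have "0 \<le> (\<tau> * sqrt ?Q - 2 * W)\<^sup>2" by simp
    then have "\<tau> * (2 * W * sqrt ?Q - \<tau> / 2 * (sqrt ?Q)\<^sup>2) \<le> 2 * W\<^sup>2"
      by (simp add: power2_eq_square algebra_simps)
    then show ?thesis using \<open>0 < \<tau>\<close> by (simp add: pos_le_divide_eq mult.commute)
  qed
  finally have "2 * (W * sqrt ?Q) + W * ?Q - \<tau> * ?Q \<le> 2 * W\<^sup>2 / \<tau>" .
  then show ?thesis using SV RV Rpp Rpq Rqq by linarith
qed

section \<open>Moment generating functions of sub-Gaussian matrices\<close>

text \<open>The point is the bare linear term: it disappears in the expectation of a centered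
  variable. On [-1, 1] the value \<open>1 + x + x^2\<close> lies between the two sides, for negative
  \<open>x\<close> by inverting the Taylor bound of \<open>exp (- x)\<close>; outside,
  \<open>x^2\<close> dominates \<open>|x|\<close>.\<close>

lemma exp_le_add_exp_square: "exp x \<le> x + exp (x\<^sup>2)" for x :: real
proof -
  have sq: "1 + x\<^sup>2 \<le> exp (x\<^sup>2)" by (rule exp_ge_add_one_self)
  consider "x < -1" | "-1 \<le> x" "x \<le> 0" | "0 < x" "x \<le> 1" | "1 < x" by linarith
  then show ?thesis
  proof cases
    case 1
    then have "1 * - x \<le> - x * - x" by (intro mult_right_mono) auto
    then have "- x \<le> x\<^sup>2" by (simp add: power2_eq_square)
    moreover have "exp x \<le> 1" using 1 by simp
    ultimately show ?thesis using sq by linarith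
  next
    case 2
    have pos: "0 < 1 - x + x\<^sup>2 / 2" using 2 by (intro add_pos_nonneg) auto
    have "1 - x + x\<^sup>2 / 2 \<le> exp (- x)"
      using exp_lower_Taylor_quadratic[of "- x"] 2 by simp
    then have "exp x \<le> inverse (1 - x + x\<^sup>2 / 2)"
      using pos le_imp_inverse_le[of "1 - x + x\<^sup>2 / 2" "exp (- x)"] by (simp add: exp_minus)
    also have "\<dots> \<le> 1 + x + x\<^sup>2"
    proof -
      have "(1 + x + x\<^sup>2) * (1 - x + x\<^sup>2 / 2) = 1 + x\<^sup>2 / 2 * (1 - x + x\<^sup>2)"
        by (simp add: power2_eq_square field_simps)
      also have "\<dots> \<ge> 1" using 2 by simp
      finally show ?thesis using pos by (simp add: inverse_eq_divide pos_divide_le_eq)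
    qed
    finally show ?thesis using sq by linarith
  next
    case 3
    then show ?thesis using exp_bound[of x] sq by linarith
  next
    case 4
    then have "1 * x \<le> x * x" by (intro mult_right_mono) auto
    then have "exp x \<le> exp (x\<^sup>2)" by (simp add: power2_eq_square)
    then show ?thesis using 4 by linarith
  qed
qed

lemma exp_scaled_le: 
  fixes \<theta> y :: real
  assumes "0 \<le> \<theta>" "\<theta> \<le> 1"
  shows "exp (\<theta> * y) \<le> 1 - \<theta> + \<theta> * exp y"
  using convex_onD[OF exp_convex, of \<theta> 0 y] assms by simp

text \<open>Small and large \<open>s\<close> need different dominating functions \<open>g\<close>;
  both give the exponent \<open>s^2 * c^2\<close> with constant 1.\<close>

lemma (in prob_space) mgf_le_of_exp_square:
  fixes X :: "'a \<Rightarrow> real"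
  assumes X[measurable]: "X \<in> borel_measurable M" and "c > 0"
    and sq: "(\<integral>\<^sup>+ \<omega>. ennreal (exp ((X \<omega>)\<^sup>2 / c\<^sup>2)) \<partial>M) \<le> 2"
    and mean: "(\<integral>\<omega>. X \<omega> \<partial>M) = 0"
  shows "(\<integral>\<^sup>+ \<omega>. ennreal (exp (s * X \<omega>)) \<partial>M) \<le> ennreal (exp (s\<^sup>2 * c\<^sup>2))"
proof -
  let ?Y = "\<lambda>\<omega>. exp ((X \<omega>)\<^sup>2 / c\<^sup>2)"
  let ?\<theta> = "s\<^sup>2 * c\<^sup>2"
  have intY: "integrable M ?Y"
    using sq by (intro integrableI_nonneg) (auto simp: less_top[symmetric] top_unique)
  have EY: "expectation ?Y \<le> 2"
  proof -
    have "ennreal (expectation ?Y) = (\<integral>\<^sup>+ \<omega>. ennreal (?Y \<omega>) \<partial>M)"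
      using intY by (intro nn_integral_eq_integral[symmetric]) auto
    then have "ennreal (expectation ?Y) \<le> ennreal 2" using sq by simp
    then show ?thesis by (subst (asm) ennreal_le_iff) auto
  qed
  \<comment> \<open>Integrability must come first: the Bochner integral of a non-integrable function
    is 0 by default, and then \<open>mean\<close> would say nothing.\<close>
  have intX: "integrable M X"
  proof (rule Bochner_Integration.integrable_bound)
    show "integrable M (\<lambda>\<omega>. c * ?Y \<omega>)" using intY by simp
    have "\<bar>X \<omega>\<bar> \<le> c * ?Y \<omega>" for \<omega>
    proof -
      let ?y = "\<bar>X \<omega>\<bar> / c"
      have "0 \<le> (1 - ?y)\<^sup>2" by simp
      then have "2 * ?y \<le> 1 + ?y\<^sup>2" by (simp add: power2_eq_square algebra_simps)
      moreover have "0 \<le> ?y" using \<open>c > 0\<close> by simp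
      ultimately have "?y \<le> 1 + ?y\<^sup>2" by linarith
      also have "\<dots> \<le> exp (?y\<^sup>2)" by (rule exp_ge_add_one_self)
      finally show ?thesis using \<open>c > 0\<close> by (simp add: power_divide pos_divide_le_eq mult.commute)
    qed
    then show "AE \<omega> in M. norm (X \<omega>) \<le> norm (c * ?Y \<omega>)" using \<open>c > 0\<close> by simp
  qed simp
  have \<theta>0: "0 \<le> ?\<theta>" by simp
  have scaled: "(s * X \<omega>)\<^sup>2 = ?\<theta> * ((X \<omega>)\<^sup>2 / c\<^sup>2)" for \<omega>
    using \<open>c > 0\<close> by (simp add: power_mult_distrib)
  obtain g where g: "integrable M g" "\<And>\<omega>. exp (s * X \<omega>) \<le> g \<omega>" "expectation g \<le> exp ?\<theta>"
  proof (cases "?\<theta> \<le> 1")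
    case True
    \<comment> \<open>For \<open>?\<theta> <= 1\<close> the term \<open>exp ((s * X)^2)\<close> is
      the power of \<open>?Y\<close> with exponent \<open>?\<theta>\<close>, bounded by convexity;
      centering then gives an expectation of at most \<open>1 + ?\<theta>\<close>.\<close>
    let ?g = "\<lambda>\<omega>. s * X \<omega> + (1 - ?\<theta> + ?\<theta> * ?Y \<omega>)"
    have "exp (s * X \<omega>) \<le> ?g \<omega>" for \<omega>
      using exp_le_add_exp_square[of "s * X \<omega>"] exp_scaled_le[OF \<theta>0 True, of "(X \<omega>)\<^sup>2 / c\<^sup>2"]
      unfolding scaled by linarith
    moreover have "expectation ?g = 1 - ?\<theta> + ?\<theta> * expectation ?Y"
      using intX intY mean by (simp add: prob_space)
    then have "expectation ?g \<le> 1 + ?\<theta>"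
      using mult_left_mono[OF EY \<theta>0] by linarith
    then have "expectation ?g \<le> exp ?\<theta>" using exp_ge_add_one_self[of ?\<theta>] by linarith
    ultimately show ?thesis using intX intY by (intro that[of ?g]) auto
  next
    case False
    \<comment> \<open>For larger \<open>?\<theta>\<close> the product \<open>s * X\<close> is split
      by the inequality of the means, and \<open>3/2 <= 1 + ?\<theta> / 2\<close> absorbs the
      constant.\<close>
    let ?g = "\<lambda>\<omega>. exp (?\<theta> / 2) * (1 / 2 + 1 / 2 * ?Y \<omega>)"
    have "exp (s * X \<omega>) \<le> ?g \<omega>" for \<omega>
    proof -
      let ?y = "(X \<omega>)\<^sup>2 / c\<^sup>2"
      have "0 \<le> (s * c - X \<omega> / c)\<^sup>2" by simp
      then have "s * X \<omega> \<le> ?\<theta> / 2 + 1 / 2 * ?y"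
        using \<open>c > 0\<close> by (simp add: power2_diff power_mult_distrib power_divide)
      then have "exp (s * X \<omega>) \<le> exp (?\<theta> / 2) * exp (1 / 2 * ?y)"
        unfolding exp_add[symmetric] by simp
      also have "\<dots> \<le> ?g \<omega>"
        using exp_scaled_le[of "1 / 2" ?y] by (intro mult_left_mono) auto
      finally show ?thesis .
    qed
    moreover have "expectation ?g \<le> exp ?\<theta>"
    proof -
      have "expectation ?g = exp (?\<theta> / 2) * (1 / 2 + 1 / 2 * expectation ?Y)"
        using intY by (simp add: prob_space)
      also have "\<dots> \<le> exp (?\<theta> / 2) * (1 + ?\<theta> / 2)"
        using EY False by (intro mult_left_mono) auto
      also have "\<dots> \<le> exp (?\<theta> / 2) * exp (?\<theta> / 2)"
        by (intro mult_left_mono exp_ge_add_one_self) auto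
      also have "\<dots> = exp ?\<theta>" by (simp add: exp_add[symmetric])
      finally show ?thesis .
    qed
    ultimately show ?thesis using intY by (intro that[of ?g]) auto
  qed
  have g0: "0 \<le> g \<omega>" for \<omega> using g(2)[of \<omega>] exp_ge_zero[of "s * X \<omega>"] by linarith
  have "(\<integral>\<^sup>+ \<omega>. ennreal (exp (s * X \<omega>)) \<partial>M) \<le> (\<integral>\<^sup>+ \<omega>. ennreal (g \<omega>) \<partial>M)"
    using g(2) by (intro nn_integral_mono ennreal_leI)
  also have "\<dots> = ennreal (expectation g)"
    using g(1) g0 by (intro nn_integral_eq_integral) auto
  also have "\<dots> \<le> ennreal (exp ?\<theta>)" using g(3) by (rule ennreal_leI)
  finally show ?thesis .
qed

text \<open>The infimum in \<open>psi2_norm\<close> need not be attained, hence the strict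
  \<open>C < c\<close>: it yields an admissible \<open>b < c\<close>, and the integral decreases as
  the scale grows.\<close>

lemma exp_square_of_psi2_norm:
  assumes "psi2_norm M X \<le> ennreal C" "C < c" "0 < c"
  shows "(\<integral>\<^sup>+ \<omega>. ennreal (exp ((X \<omega>)\<^sup>2 / c\<^sup>2)) \<partial>M) \<le> 2"
proof -
  have "psi2_norm M X < ennreal c"
    using assms by (metis ennreal_lessI le_less_trans)
  then obtain b where b: "b > 0" "(\<integral>\<^sup>+ \<omega>. ennreal (exp ((X \<omega>)\<^sup>2 / b\<^sup>2)) \<partial>M) < 2" "ennreal b < ennreal c"
    unfolding psi2_norm_def Inf_less_iff by auto
  then have "b \<le> c" by (simp add: ennreal_less_iff)
  then have "(X \<omega>)\<^sup>2 / c\<^sup>2 \<le> (X \<omega>)\<^sup>2 / b\<^sup>2" for \<omega>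
    using b(1) by (intro divide_left_mono power_mono) auto
  then have "(\<integral>\<^sup>+ \<omega>. ennreal (exp ((X \<omega>)\<^sup>2 / c\<^sup>2)) \<partial>M) \<le> (\<integral>\<^sup>+ \<omega>. ennreal (exp ((X \<omega>)\<^sup>2 / b\<^sup>2)) \<partial>M)"
    by (intro nn_integral_mono ennreal_leI) simp
  then show ?thesis using b(2) by (meson le_less_trans less_imp_le)
qed

text \<open>Only the entries on and above the diagonal are independent; in the bilinear form each of them
  carries the weight of its mirror image as well.\<close>

definition upper_pairs :: "nat \<Rightarrow> (nat \<times> nat) set" where
  "upper_pairs n = {(i, j). i \<le> j \<and> j < n}"

lemma finite_upper_pairs: "finite (upper_pairs n)"
proof (rule finite_subset)
  show "upper_pairs n \<subseteq> {..<n} \<times> {..<n}" by (auto simp: upper_pairs_def)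
qed simp

text \<open>Induction on \<open>n\<close> strips off the last row and column, whose off-diagonal
  entries form the mirror pairs.\<close>

lemma sum_square_eq_sum_upper_pairs:
  fixes g :: "nat \<Rightarrow> nat \<Rightarrow> 'b::comm_monoid_add"
  shows "(\<Sum>i<n. \<Sum>j<n. g i j) = (\<Sum>(i, j)\<in>upper_pairs n. if i = j then g i i else g i j + g j i)"
proof (induction n)
  case (Suc n)
  have up: "upper_pairs (Suc n) = upper_pairs n \<union> (\<lambda>i. (i, n)) ` {..n}"
    by (auto simp: upper_pairs_def less_Suc_eq)
  have inj: "inj_on (\<lambda>i. (i, n)) {..n}" by (auto simp: inj_on_def)
  have "(\<Sum>(i, j)\<in>upper_pairs (Suc n). if i = j then g i i else g i j + g j i)
     = (\<Sum>(i, j)\<in>upper_pairs n. if i = j then g i i else g i j + g j i)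
     + (\<Sum>i\<le>n. if i = n then g i i else g i n + g n i)"
    unfolding up by (subst sum.union_disjoint)
      (auto simp: finite_upper_pairs[unfolded upper_pairs_def] upper_pairs_def sum.reindex[OF inj])
  also have "(\<Sum>i\<le>n. if i = n then g i i else g i n + g n i) = (\<Sum>i<n. g i n + g n i) + g n n"
    by (simp add: lessThan_Suc_atMost[symmetric])
  finally show ?case
    using Suc by (simp add: sum.distrib ac_simps)
qed (simp add: upper_pairs_def)

definition pair_weight :: "(nat \<Rightarrow> real) \<Rightarrow> (nat \<Rightarrow> real) \<Rightarrow> nat \<times> nat \<Rightarrow> real" where
  "pair_weight x y = (\<lambda>(i, j). if i = j then x i * y i else x i * y j + x j * y i)"

lemma bf_eq_sum_upper_pairs:
  assumes sym: "\<And>i j. i < n \<Longrightarrow> j < n \<Longrightarrow> S i j = S j i"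
  shows "bf n S x y = (\<Sum>p\<in>upper_pairs n. pair_weight x y p * (case p of (i, j) \<Rightarrow> S i j))"
  unfolding bf_alt sum_square_eq_sum_upper_pairs
  by (intro sum.cong refl) (auto simp: pair_weight_def upper_pairs_def sym algebra_simps)

text \<open>Mirror terms are separated by \<open>(a + b)^2 <= 2 * a^2 + 2 * b^2\<close>. The
  diagonal gets the factor 2 as well, so that the sum over pairs folds back into the full double
  sum.\<close>

lemma sum_pair_weight_square_le:
  "(\<Sum>p\<in>upper_pairs n. (pair_weight x y p)\<^sup>2) \<le> 2 * (ip n x x * ip n y y)"
proof -
  have "(\<Sum>p\<in>upper_pairs n. (pair_weight x y p)\<^sup>2)
    \<le> (\<Sum>(i, j)\<in>upper_pairs n. if i = j then 2 * (x i * y i)\<^sup>2 else 2 * (x i * y j)\<^sup>2 + 2 * (x j * y i)\<^sup>2)"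
  proof (rule sum_mono)
    fix p assume "p \<in> upper_pairs n"
    obtain i j where p: "p = (i, j)" by fastforce
    have "(a + b)\<^sup>2 \<le> 2 * a\<^sup>2 + 2 * b\<^sup>2" for a b :: real
      using zero_le_power2[of "a - b"] by (simp add: power2_sum power2_diff)
    then show "(pair_weight x y p)\<^sup>2 \<le> (case p of (i, j) \<Rightarrow> if i = j then 2 * (x i * y i)\<^sup>2 else 2 * (x i * y j)\<^sup>2 + 2 * (x j * y i)\<^sup>2)"
      by (simp add: p pair_weight_def)
  qed
  also have "\<dots> = (\<Sum>i<n. \<Sum>j<n. 2 * (x i * y j)\<^sup>2)"
    unfolding sum_square_eq_sum_upper_pairs ..
  also have "\<dots> = 2 * (ip n x x * ip n y y)"
  proof -
    have "ip n x x * ip n y y = (\<Sum>i<n. \<Sum>j<n. (x i * y j)\<^sup>2)"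
      unfolding ip_def sum_product by (simp add: power2_eq_square mult_ac)
    then show ?thesis by (simp add: sum_distrib_left)
  qed
  finally show ?thesis .
qed

section \<open>Bilinear forms of a sub-Gaussian matrix\<close>

lemma sub_gaussian_matrix_symmetric:
  assumes "sub_gaussian_matrix C1 C2 M n E" "\<omega> \<in> space M" "i < n" "j < n"
  shows "E \<omega> $$ (i, j) = E \<omega> $$ (j, i)"
  using assms symmetric_mat_entries[of "E \<omega>" n i j] by (auto simp: sub_gaussian_matrix_def)

lemma sub_gaussian_matrix_entry_measurable:
  assumes E: "sub_gaussian_matrix C1 C2 M n E" and "i < n" "j < n"
  shows "(\<lambda>\<omega>. E \<omega> $$ (i, j)) \<in> borel_measurable M"
proof -
  \<comment> \<open>Independence supplies measurability on and above the diagonal; the entries below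
    are reached by symmetry, which holds on \<open>space M\<close>.\<close>
  have up: "(\<lambda>\<omega>. E \<omega> $$ (i, j)) \<in> borel_measurable M" if "i \<le> j" "j < n" for i j
  proof -
    interpret prob_space M using E by (simp add: sub_gaussian_matrix_def)
    have "indep_vars (\<lambda>_. borel) (\<lambda>(i, j) \<omega>. E \<omega> $$ (i, j)) {(i, j). i \<le> j \<and> j < n}"
      using E by (simp add: sub_gaussian_matrix_def)
    then show ?thesis using that unfolding indep_vars_def2 by auto
  qed
  show ?thesis
  proof (cases "i \<le> j")
    case False
    then have "(\<lambda>\<omega>. E \<omega> $$ (j, i)) \<in> borel_measurable M" using up assms by simp
    moreover have "E \<omega> $$ (i, j) = E \<omega> $$ (j, i)" if "\<omega> \<in> space M" for \<omega>
      using sub_gaussian_matrix_symmetric[OF E that] assms by simp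
    ultimately show ?thesis using measurable_cong[of M "\<lambda>\<omega>. E \<omega> $$ (i, j)" "\<lambda>\<omega>. E \<omega> $$ (j, i)"] by simp
  qed (use up assms in simp)
qed

lemma sub_gaussian_matrix_bf_measurable:
  assumes "sub_gaussian_matrix C1 C2 M n E"
  shows "(\<lambda>\<omega>. bf n (entries (E \<omega>)) x y) \<in> borel_measurable M"
  unfolding bf_alt
  by (intro borel_measurable_sum borel_measurable_times borel_measurable_const
      sub_gaussian_matrix_entry_measurable[OF assms]) auto

text \<open>Independence turns the expectation into a product over pairs, in which the exponents add
  up to a multiple of the sum of squared pair weights. The bound sees \<open>x\<close> and
  \<open>y\<close> only through their lengths.\<close>

theorem sub_gaussian_matrix_bf_mgf:
  assumes E: "sub_gaussian_matrix C1 C2 M n E" and c: "C2 < c" "0 < c"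
  shows "(\<integral>\<^sup>+ \<omega>. ennreal (exp (s * bf n (entries (E \<omega>)) x y)) \<partial>M)
     \<le> ennreal (exp (2 * s\<^sup>2 * c\<^sup>2 * (ip n x x * ip n y y)))"
proof -
  interpret prob_space M using E by (simp add: sub_gaussian_matrix_def)
  let ?w = "pair_weight x y"
  let ?X = "\<lambda>p \<omega>. case p of (i, j) \<Rightarrow> E \<omega> $$ (i, j)"
  have ind: "indep_vars (\<lambda>_. borel) (\<lambda>p \<omega>. ?X p \<omega>) (upper_pairs n)"
    using E by (simp add: sub_gaussian_matrix_def upper_pairs_def case_prod_beta')
  have "(\<integral>\<^sup>+ \<omega>. ennreal (exp (s * bf n (entries (E \<omega>)) x y)) \<partial>M)
      = (\<integral>\<^sup>+ \<omega>. (\<Prod>p\<in>upper_pairs n. ennreal (exp (s * ?w p * ?X p \<omega>))) \<partial>M)"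
  proof (rule nn_integral_cong)
    fix \<omega> assume \<omega>: "\<omega> \<in> space M"
    have "s * bf n (entries (E \<omega>)) x y = (\<Sum>p\<in>upper_pairs n. s * ?w p * ?X p \<omega>)"
      using sub_gaussian_matrix_symmetric[OF E \<omega>]
      by (subst bf_eq_sum_upper_pairs) (auto simp: sum_distrib_left mult.assoc case_prod_beta)
    then have "exp (s * bf n (entries (E \<omega>)) x y) = (\<Prod>p\<in>upper_pairs n. exp (s * ?w p * ?X p \<omega>))"
      by (simp add: exp_sum finite_upper_pairs)
    then show "ennreal (exp (s * bf n (entries (E \<omega>)) x y)) = (\<Prod>p\<in>upper_pairs n. ennreal (exp (s * ?w p * ?X p \<omega>)))"
      by (simp add: prod_ennreal)
  qed
  also have "\<dots> = (\<Prod>p\<in>upper_pairs n. \<integral>\<^sup>+ \<omega>. ennreal (exp (s * ?w p * ?X p \<omega>)) \<partial>M)"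
    by (intro indep_vars_nn_integral finite_upper_pairs
        indep_vars_compose2[OF ind, where Y="\<lambda>p z. ennreal (exp (s * ?w p * z))"]) auto
  also have "\<dots> \<le> (\<Prod>p\<in>upper_pairs n. ennreal (exp ((s * ?w p)\<^sup>2 * c\<^sup>2)))"
  proof (rule prod_mono_ennreal)
    fix p assume "p \<in> upper_pairs n"
    then obtain i j where p: "p = (i, j)" and ij: "i < n" "j < n" by (auto simp: upper_pairs_def)
    have "(\<integral>\<^sup>+ \<omega>. ennreal (exp ((E \<omega> $$ (i, j))\<^sup>2 / c\<^sup>2)) \<partial>M) \<le> 2"
      by (rule exp_square_of_psi2_norm[OF _ c]) (use E ij in \<open>simp add: sub_gaussian_matrix_def\<close>)
    moreover have "(\<integral>\<omega>. E \<omega> $$ (i, j) \<partial>M) = 0"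
      using E ij by (simp add: sub_gaussian_matrix_def)
    ultimately show "(\<integral>\<^sup>+ \<omega>. ennreal (exp (s * ?w p * ?X p \<omega>)) \<partial>M) \<le> ennreal (exp ((s * ?w p)\<^sup>2 * c\<^sup>2))"
      unfolding p prod.case
      by (intro mgf_le_of_exp_square sub_gaussian_matrix_entry_measurable[OF E ij] c)
  qed
  also have "\<dots> = ennreal (exp (\<Sum>p\<in>upper_pairs n. (s * ?w p)\<^sup>2 * c\<^sup>2))"
    by (simp add: prod_ennreal exp_sum finite_upper_pairs)
  also have "\<dots> \<le> ennreal (exp (2 * s\<^sup>2 * c\<^sup>2 * (ip n x x * ip n y y)))"
  proof -
    have "(\<Sum>p\<in>upper_pairs n. (s * ?w p)\<^sup>2 * c\<^sup>2) = s\<^sup>2 * c\<^sup>2 * (\<Sum>p\<in>upper_pairs n. (?w p)\<^sup>2)"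
      by (simp add: sum_distrib_left power_mult_distrib ac_simps)
    also have "\<dots> \<le> s\<^sup>2 * c\<^sup>2 * (2 * (ip n x x * ip n y y))"
      by (intro mult_left_mono sum_pair_weight_square_le) auto
    finally show ?thesis by (intro ennreal_leI) (simp add: ac_simps)
  qed
  finally show ?thesis .
qed

section \<open>The event and its probability\<close>

text \<open>A countable family of constraints, whence the measurability of the top eigenvalue.\<close>

lemma nth_eigenvalue_1_le_iff_integer_vectors:
  assumes S: "S \<in> carrier_mat n n" "symmetric_mat S" and "0 < n"
  shows "nth_eigenvalue S 1 \<le> b \<longleftrightarrow>
    (\<forall>m\<in>{..<n} \<rightarrow>\<^sub>E (UNIV :: int set). bf n (entries S) (\<lambda>i. of_int (m i)) (\<lambda>i. of_int (m i))
       \<le> b * ip n (\<lambda>i. of_int (m i)) (\<lambda>i. of_int (m i)))"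
    (is "?l \<longleftrightarrow> ?r")
proof
  assume ?l
  show ?r
  proof
    fix m :: "nat \<Rightarrow> int"
    let ?m = "\<lambda>i. real_of_int (m i)"
    have "bf n (entries S) ?m ?m \<le> nth_eigenvalue S 1 * ip n ?m ?m"
      by (rule symmetric_mat_top_eigenvalue(1)[OF assms])
    also have "\<dots> \<le> b * ip n ?m ?m" using \<open>?l\<close> by (intro mult_right_mono) auto
    finally show "bf n (entries S) ?m ?m \<le> b * ip n ?m ?m" .
  qed
next
  assume r: ?r
  obtain v where v: "ip n v v = 1" "bf n (entries S) v v = nth_eigenvalue S 1"
    using symmetric_mat_top_eigenvalue(2)[OF assms] by blast
  \<comment> \<open>Rounding gives vectors with rational coordinates that converge to
    \<open>v\<close>. The inequality is homogeneous of degree two, so it passes from integer vectors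
    to \<open>z N\<close> and then to the limit.\<close>
  define z where "z = (\<lambda>N i. real_of_int \<lfloor>real (Suc N) * v i\<rfloor> / real (Suc N))"
  have lim: "(\<lambda>N. z N i) \<longlonglongrightarrow> v i" for i
  proof (rule LIMSEQ_norm_0[of "\<lambda>N. z N i - v i", THEN LIM_zero_cancel])
    fix N
    have "z N i - v i = (real_of_int \<lfloor>real (Suc N) * v i\<rfloor> - real (Suc N) * v i) / real (Suc N)"
      by (simp add: z_def field_simps del: of_nat_Suc)
    moreover have "\<bar>real_of_int \<lfloor>real (Suc N) * v i\<rfloor> - real (Suc N) * v i\<bar> < 1" by linarith
    ultimately show "norm (z N i - v i) < 1 / real (Suc N)"
      by (simp add: divide_strict_right_mono del: of_nat_Suc)
  qed
  have le: "bf n (entries S) (z N) (z N) \<le> b * ip n (z N) (z N)" for N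
  proof -
    define m where "m = (\<lambda>i\<in>{..<n}. \<lfloor>real (Suc N) * v i\<rfloor>)"
    let ?m = "\<lambda>i. real_of_int (m i)"
    let ?c = "1 / real (Suc N)"
    have zm: "z N i = ?c * ?m i" if "i < n" for i using that by (simp add: z_def m_def)
    have "m \<in> {..<n} \<rightarrow>\<^sub>E UNIV" by (simp add: m_def)
    then have "bf n (entries S) ?m ?m \<le> b * ip n ?m ?m" using r by blast
    then have "?c * (?c * bf n (entries S) ?m ?m) \<le> ?c * (?c * (b * ip n ?m ?m))"
      by (intro mult_left_mono) auto
    also have "?c * (?c * bf n (entries S) ?m ?m) = bf n (entries S) (\<lambda>i. ?c * ?m i) (\<lambda>i. ?c * ?m i)"
      by (simp only: bf_linear)
    also have "\<dots> = bf n (entries S) (z N) (z N)" using zm by (intro bf_cong) auto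
    also have "?c * (?c * (b * ip n ?m ?m)) = b * ip n (\<lambda>i. ?c * ?m i) (\<lambda>i. ?c * ?m i)"
      by (simp only: ip_linear mult.left_commute)
    also have "ip n (\<lambda>i. ?c * ?m i) (\<lambda>i. ?c * ?m i) = ip n (z N) (z N)"
      using zm by (intro ip_cong) auto
    finally show ?thesis .
  qed
  have "(\<lambda>N. bf n (entries S) (z N) (z N)) \<longlonglongrightarrow> bf n (entries S) v v"
    unfolding bf_alt by (intro tendsto_intros lim)
  moreover have "(\<lambda>N. b * ip n (z N) (z N)) \<longlonglongrightarrow> b * ip n v v"
    unfolding ip_def by (intro tendsto_intros lim)
  ultimately have "bf n (entries S) v v \<le> b * ip n v v"
    using le by (intro LIMSEQ_le) auto
  then show ?l using v by simp
qed

lemma symmetric_mat_add: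
  assumes "S \<in> carrier_mat n n" "symmetric_mat S" "R \<in> carrier_mat n n" "symmetric_mat R"
  shows "symmetric_mat (S + R)"
  using assms by (auto simp: symmetric_mat_def transpose_add)

lemma bf_add_mat:
  assumes "S \<in> carrier_mat n n" "R \<in> carrier_mat n n"
  shows "bf n (entries (S + R)) x y = bf n (entries S) x y + bf n (entries R) x y"
  using assms by (simp add: bf_alt distrib_right sum.distrib)

lemma measurable_top_eigenvalue_le:
  assumes E: "sub_gaussian_matrix C1 C2 M n E" and S: "S \<in> carrier_mat n n" "symmetric_mat S" and n: "0 < n"
  shows "{\<omega> \<in> space M. nth_eigenvalue (S + E \<omega>) 1 \<le> b} \<in> sets M"
proof -
  let ?q = "\<lambda>R m. bf n (entries R) (\<lambda>i. real_of_int (m i)) (\<lambda>i. real_of_int (m i))"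
  let ?D = "{..<n} \<rightarrow>\<^sub>E (UNIV :: int set)"
  have "{\<omega> \<in> space M. nth_eigenvalue (S + E \<omega>) 1 \<le> b} =
    {\<omega> \<in> space M. \<forall>m\<in>?D. ?q S m + ?q (E \<omega>) m \<le> b * ip n (\<lambda>i. of_int (m i)) (\<lambda>i. of_int (m i))}"
  proof (intro Collect_cong conj_cong refl)
    fix \<omega> assume "\<omega> \<in> space M"
    then have R: "E \<omega> \<in> carrier_mat n n" "symmetric_mat (E \<omega>)"
      using E by (auto simp: sub_gaussian_matrix_def)
    have "S + E \<omega> \<in> carrier_mat n n" using S R by simp
    then show "nth_eigenvalue (S + E \<omega>) 1 \<le> b \<longleftrightarrow>
      (\<forall>m\<in>?D. ?q S m + ?q (E \<omega>) m \<le> b * ip n (\<lambda>i. of_int (m i)) (\<lambda>i. of_int (m i)))"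
      using nth_eigenvalue_1_le_iff_integer_vectors[OF _ symmetric_mat_add[OF S R] n]
      unfolding bf_add_mat[OF S(1) R(1)] by blast
  qed
  also have "\<dots> \<in> sets M"
  proof (rule sets.sets_Collect_countable_All')
    show "countable ?D" by (intro countable_PiE) auto
    fix m :: "nat \<Rightarrow> int"
    note [measurable] = sub_gaussian_matrix_bf_measurable[OF E]
    show "{\<omega> \<in> space M. ?q S m + ?q (E \<omega>) m \<le> b * ip n (\<lambda>i. of_int (m i)) (\<lambda>i. of_int (m i))} \<in> sets M"
      by measurable
  qed
  finally show ?thesis .
qed

section \<open>Tail bounds for single forms, for the net and for the compression\<close>

lemma sub_gaussian_matrix_bf_tail:
  assumes E: "sub_gaussian_matrix C1 C2 M n E" and c: "C2 < c" "0 < c" and s: "0 \<le> s"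
  shows "emeasure M {\<omega> \<in> space M. a < \<bar>bf n (entries (E \<omega>)) x y\<bar>}
    \<le> ennreal (2 * exp (2 * s\<^sup>2 * c\<^sup>2 * (ip n x x * ip n y y) - s * a))"
proof -
  let ?b = "\<lambda>\<omega>. bf n (entries (E \<omega>)) x y"
  let ?e = "exp (2 * s\<^sup>2 * c\<^sup>2 * (ip n x x * ip n y y))"
  note [measurable] = sub_gaussian_matrix_bf_measurable[OF E]
  have "emeasure M {\<omega> \<in> space M. a < \<bar>?b \<omega>\<bar>} = (\<integral>\<^sup>+ \<omega>. indicator {\<omega> \<in> space M. a < \<bar>?b \<omega>\<bar>} \<omega> \<partial>M)"
    by (rule nn_integral_indicator[symmetric]) measurable
  \<comment> \<open>Chernoff's bound for both signs at once: where the form exceeds \<open>a\<close>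
    in modulus, one of the two exponentials times \<open>exp (- (s * a))\<close> is at least
    1.\<close>
  also have "\<dots> \<le> (\<integral>\<^sup>+ \<omega>. ennreal (exp (- (s * a))) * (ennreal (exp (s * ?b \<omega>)) + ennreal (exp ((- s) * ?b \<omega>))) \<partial>M)"
  proof (rule nn_integral_mono)
    fix \<omega>
    show "indicator {\<omega> \<in> space M. a < \<bar>?b \<omega>\<bar>} \<omega>
        \<le> ennreal (exp (- (s * a))) * (ennreal (exp (s * ?b \<omega>)) + ennreal (exp ((- s) * ?b \<omega>)))"
    proof (cases "a < \<bar>?b \<omega>\<bar>")
      case True
      have "s * a \<le> s * \<bar>?b \<omega>\<bar>" using True s by (intro mult_left_mono) auto
      moreover have "s * \<bar>?b \<omega>\<bar> = s * ?b \<omega> \<or> s * \<bar>?b \<omega>\<bar> = (- s) * ?b \<omega>"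
        by (cases "0 \<le> ?b \<omega>") simp_all
      ultimately have "0 \<le> s * ?b \<omega> - s * a \<or> 0 \<le> (- s) * ?b \<omega> - s * a" by linarith
      then have "1 \<le> exp (s * ?b \<omega> - s * a) + exp ((- s) * ?b \<omega> - s * a)"
        by (metis add_increasing add_increasing2 exp_ge_zero one_le_exp_iff)
      also have "\<dots> = exp (- (s * a)) * (exp (s * ?b \<omega>) + exp ((- s) * ?b \<omega>))"
        by (simp add: exp_diff exp_minus field_simps)
      finally have "ennreal 1 \<le> ennreal \<dots>" by (rule ennreal_leI)
      then show ?thesis by (simp add: ennreal_mult indicator_def del: mult_minus_left)
    qed (simp add: indicator_def)
  qed
  also have "\<dots> = ennreal (exp (- (s * a))) * ((\<integral>\<^sup>+ \<omega>. ennreal (exp (s * ?b \<omega>)) \<partial>M) + (\<integral>\<^sup>+ \<omega>. ennreal (exp ((- s) * ?b \<omega>)) \<partial>M))"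
    by (subst nn_integral_cmult, measurable, subst nn_integral_add, measurable)
  also have "\<dots> \<le> ennreal (exp (- (s * a))) * (ennreal ?e + ennreal ?e)"
    using sub_gaussian_matrix_bf_mgf[OF E c, of s x y] sub_gaussian_matrix_bf_mgf[OF E c, of "- s" x y]
    by (intro mult_left_mono add_mono) auto
  also have "\<dots> = ennreal (exp (- (s * a)) * (?e + ?e))"
    by (simp only: ennreal_mult ennreal_plus exp_ge_zero add_nonneg_nonneg)
  also have "exp (- (s * a)) * (?e + ?e) = 2 * exp (2 * s\<^sup>2 * c\<^sup>2 * (ip n x x * ip n y y) - s * a)"
    by (simp add: exp_diff exp_minus field_simps)
  finally show ?thesis .
qed

text \<open>A union bound over the net. Each point contributes at most
  \<open>2 * exp (- 19 * n)\<close>, and the at most \<open>exp (18 * n)\<close> points leave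
  \<open>2 * exp (- n)\<close>; the 19 in the threshold is chosen for this.\<close>

lemma sub_gaussian_matrix_net_tail:
  assumes E: "sub_gaussian_matrix C1 C2 M n E" and c: "C2 < c" "0 < c" and n: "0 < n"
  shows "emeasure M {\<omega> \<in> space M. \<exists>m\<in>lattice_net n. 16 * real n * ((2 * c\<^sup>2 + 19) * sqrt n)
      < \<bar>bf n (entries (E \<omega>)) (\<lambda>i. of_int (m i)) (\<lambda>i. of_int (m i))\<bar>} \<le> ennreal (2 * exp (- real n))"
proof -
  let ?a = "16 * real n * ((2 * c\<^sup>2 + 19) * sqrt n)"
  define A where "A = (\<lambda>m. {\<omega> \<in> space M. ?a < \<bar>bf n (entries (E \<omega>)) (\<lambda>i. of_int (m i)) (\<lambda>i. of_int (m i))\<bar>})"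
  \<comment> \<open>With this \<open>s\<close> and squared lengths at most \<open>16 * n\<close>,
    the moment term is at most \<open>2 * c^2 * n\<close>, while \<open>s\<close> times the
    threshold is \<open>(2 * c^2 + 19) * n\<close>.\<close>
  let ?s = "1 / (16 * sqrt n)"
  define t where "t = 2 * exp (2 * c\<^sup>2 * n - (2 * c\<^sup>2 + 19) * n)"
  have t0: "0 \<le> t" by (simp add: t_def)
  note [measurable] = sub_gaussian_matrix_bf_measurable[OF E]
  have one: "emeasure M (A m) \<le> ennreal t" if m: "m \<in> lattice_net n" for m
  proof -
    let ?m = "\<lambda>i. real_of_int (m i)"
    have "real_of_int (\<Sum>i<n. (m i)\<^sup>2) \<le> real_of_int (int (16 * n))"
      using m unfolding lattice_net_def of_int_le_iff by simp
    then have mm: "ip n ?m ?m \<le> 16 * real n" by (simp add: ip_def power2_eq_square)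
    have "2 * ?s\<^sup>2 * c\<^sup>2 * (ip n ?m ?m * ip n ?m ?m) \<le> 2 * ?s\<^sup>2 * c\<^sup>2 * ((16 * real n) * (16 * real n))"
      by (intro mult_left_mono mult_mono mm) auto
    also have "\<dots> = 2 * c\<^sup>2 * n" using n by (simp add: power_divide power_mult_distrib)
    finally have 1: "2 * ?s\<^sup>2 * c\<^sup>2 * (ip n ?m ?m * ip n ?m ?m) \<le> 2 * c\<^sup>2 * n" .
    have 2: "?s * ?a = (2 * c\<^sup>2 + 19) * n" using n by simp
    have "emeasure M (A m) \<le> ennreal (2 * exp (2 * ?s\<^sup>2 * c\<^sup>2 * (ip n ?m ?m * ip n ?m ?m) - ?s * ?a))"
      unfolding A_def by (rule sub_gaussian_matrix_bf_tail[OF E c]) simp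
    also have "\<dots> \<le> ennreal t"
      unfolding 2 t_def using 1 by (intro ennreal_leI) simp
    finally show ?thesis .
  qed
  have "{\<omega> \<in> space M. \<exists>m\<in>lattice_net n. ?a < \<bar>bf n (entries (E \<omega>)) (\<lambda>i. of_int (m i)) (\<lambda>i. of_int (m i))\<bar>}
      = (\<Union>m\<in>lattice_net n. A m)" by (auto simp: A_def)
  also have "emeasure M \<dots> \<le> (\<Sum>m\<in>lattice_net n. emeasure M (A m))"
    by (rule emeasure_subadditive_finite) (auto simp: finite_lattice_net A_def)
  also have "\<dots> \<le> (\<Sum>m\<in>lattice_net n. ennreal t)"
    by (intro sum_mono one)
  also have "\<dots> = ennreal (real (card (lattice_net n)) * t)"
    unfolding sum_constant ennreal_of_nat_eq_real_of_nat by (rule ennreal_mult[symmetric]) (simp_all add: t0)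
  also have "\<dots> \<le> ennreal (exp (18 * real n) * t)"
    by (intro ennreal_leI mult_right_mono card_lattice_net t0)
  also have "exp (18 * real n) * t = 2 * exp (18 * real n + (2 * c\<^sup>2 * n - (2 * c\<^sup>2 + 19) * n))"
    unfolding t_def by (simp add: exp_add)
  also have "18 * real n + (2 * c\<^sup>2 * n - (2 * c\<^sup>2 + 19) * n) = - real n" by (simp add: algebra_simps)
  finally show ?thesis .
qed

text \<open>Markov's inequality for the squared Frobenius norm of the compression: its
  \<open>r^2\<close> entries are forms at unit vectors, with second moments bounded through the
  moment generating function at 1 and -1.\<close>

lemma sub_gaussian_matrix_block_tail:
  assumes E: "sub_gaussian_matrix C1 C2 M n E" and c: "C2 < c" "0 < c"
    and on: "orthonormal n r u" and r: "0 < r" and h: "0 < h"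
  shows "emeasure M {\<omega> \<in> space M. (real r)\<^sup>2 * h < (\<Sum>k<r. \<Sum>l<r. (bf n (entries (E \<omega>)) (u k) (u l))\<^sup>2)}
     \<le> ennreal (8 * exp (2 * c\<^sup>2) / h)"
proof -
  let ?b = "\<lambda>k l \<omega>. bf n (entries (E \<omega>)) (u k) (u l)"
  let ?F = "\<lambda>\<omega>. \<Sum>k<r. \<Sum>l<r. (?b k l \<omega>)\<^sup>2"
  let ?A = "{\<omega> \<in> space M. (real r)\<^sup>2 * h < ?F \<omega>}"
  let ?a = "1 / ((real r)\<^sup>2 * h)"
  have a: "0 < (real r)\<^sup>2 * h" using r h by simp
  note [measurable] = sub_gaussian_matrix_bf_measurable[OF E]
  have second: "(\<integral>\<^sup>+ \<omega>. ennreal ((?b k l \<omega>)\<^sup>2) \<partial>M) \<le> ennreal (8 * exp (2 * c\<^sup>2))" if "k < r" "l < r" for k l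
  proof -
    have y: "y\<^sup>2 \<le> 4 * (exp y + exp (- y))" for y :: real
    proof -
      have *: "z\<^sup>2 \<le> 4 * exp z" if "0 \<le> z" for z :: real
      proof -
        have "(z / 2)\<^sup>2 \<le> (exp (z / 2))\<^sup>2"
          using exp_ge_add_one_self[of "z / 2"] that by (intro power_mono) linarith+
        also have "\<dots> = exp z" by (simp add: power2_eq_square exp_add[symmetric])
        finally show ?thesis by (simp add: power_divide)
      qed
      have "exp \<bar>y\<bar> \<le> exp y + exp (- y)" by (simp add: abs_if)
      then show ?thesis using *[of "\<bar>y\<bar>"] by simp
    qed
    have "(\<integral>\<^sup>+ \<omega>. ennreal ((?b k l \<omega>)\<^sup>2) \<partial>M) \<le>
      (\<integral>\<^sup>+ \<omega>. ennreal 4 * (ennreal (exp (1 * ?b k l \<omega>)) + ennreal (exp ((- 1) * ?b k l \<omega>))) \<partial>M)"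
    proof (rule nn_integral_mono)
      fix \<omega>
      have "ennreal ((?b k l \<omega>)\<^sup>2) \<le> ennreal (4 * (exp (?b k l \<omega>) + exp (- ?b k l \<omega>)))"
        using y[of "?b k l \<omega>"] by (rule ennreal_leI)
      then show "ennreal ((?b k l \<omega>)\<^sup>2) \<le> ennreal 4 * (ennreal (exp (1 * ?b k l \<omega>)) + ennreal (exp ((- 1) * ?b k l \<omega>)))"
        by (simp only: ennreal_mult ennreal_plus mult_1 mult_minus1 exp_ge_zero add_nonneg_nonneg zero_le_numeral)
    qed
    also have "\<dots> = ennreal 4 * ((\<integral>\<^sup>+ \<omega>. ennreal (exp (1 * ?b k l \<omega>)) \<partial>M) + (\<integral>\<^sup>+ \<omega>. ennreal (exp ((- 1) * ?b k l \<omega>)) \<partial>M))"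
      by (subst nn_integral_cmult, measurable, subst nn_integral_add, measurable)
    also have "\<dots> \<le> ennreal 4 * (ennreal (exp (2 * c\<^sup>2)) + ennreal (exp (2 * c\<^sup>2)))"
      using sub_gaussian_matrix_bf_mgf[OF E c, of 1 "u k" "u l"] sub_gaussian_matrix_bf_mgf[OF E c, of "- 1" "u k" "u l"]
        orthonormal_ip[OF on] that
      by (intro mult_left_mono add_mono) auto
    also have "\<dots> = ennreal (4 * (exp (2 * c\<^sup>2) + exp (2 * c\<^sup>2)))"
      by (simp only: ennreal_mult ennreal_plus exp_ge_zero add_nonneg_nonneg zero_le_numeral)
    finally show ?thesis by simp
  qed
  have "emeasure M ?A = (\<integral>\<^sup>+ \<omega>. indicator ?A \<omega> \<partial>M)"
    by (rule nn_integral_indicator[symmetric]) measurable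
  also have "\<dots> \<le> (\<integral>\<^sup>+ \<omega>. ennreal ?a * (\<Sum>k<r. \<Sum>l<r. ennreal ((?b k l \<omega>)\<^sup>2)) \<partial>M)"
  proof (rule nn_integral_mono)
    fix \<omega>
    have F0: "0 \<le> ?F \<omega>" by (intro sum_nonneg) auto
    have sum: "(\<Sum>k<r. \<Sum>l<r. ennreal ((?b k l \<omega>)\<^sup>2)) = ennreal (?F \<omega>)"
      by (simp add: sum_nonneg)
    show "indicator ?A \<omega> \<le> ennreal ?a * (\<Sum>k<r. \<Sum>l<r. ennreal ((?b k l \<omega>)\<^sup>2))"
    proof (cases "\<omega> \<in> ?A")
      case True
      then have "1 \<le> ?a * ?F \<omega>" using a by (simp add: le_divide_eq)
      then have "ennreal 1 \<le> ennreal (?a * ?F \<omega>)" by (rule ennreal_leI)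
      then show ?thesis unfolding sum using a F0 True by (simp add: ennreal_mult[symmetric])
    qed simp
  qed
  also have "\<dots> = ennreal ?a * (\<Sum>k<r. \<Sum>l<r. \<integral>\<^sup>+ \<omega>. ennreal ((?b k l \<omega>)\<^sup>2) \<partial>M)"
    by (simp add: nn_integral_cmult nn_integral_sum del: sum_ennreal)
  also have "\<dots> \<le> ennreal ?a * (\<Sum>k<r. \<Sum>l<r. ennreal (8 * exp (2 * c\<^sup>2)))"
    using second by (intro mult_left_mono sum_mono) auto
  also have "(\<Sum>k<r. \<Sum>l<r. ennreal (8 * exp (2 * c\<^sup>2))) = ennreal ((real r)\<^sup>2 * (8 * exp (2 * c\<^sup>2)))"
    by (subst sum_ennreal, simp)+ (simp add: power2_eq_square)
  also have "ennreal ?a * \<dots> = ennreal (?a * ((real r)\<^sup>2 * (8 * exp (2 * c\<^sup>2))))"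
    using a by (intro ennreal_mult[symmetric]) auto
  also have "?a * ((real r)\<^sup>2 * (8 * exp (2 * c\<^sup>2))) = 8 * exp (2 * c\<^sup>2) / h"
    using r by simp
  finally show ?thesis .
qed

section \<open>Deterministic bound on the good event\<close>

lemma eigenvalue_gap_of_count:
  assumes dec: "\<And>k l. k \<le> l \<Longrightarrow> l < n \<Longrightarrow> \<Lambda> (Suc l) \<le> (\<Lambda> (Suc k) :: real)"
    and r: "r = card {i \<in> {1..n}. \<Lambda> i > t}" and k: "r \<le> k" "k < n"
  shows "\<Lambda> (Suc k) \<le> t"
proof (rule ccontr)
  assume "\<not> \<Lambda> (Suc k) \<le> t"
  then have gt: "\<Lambda> (Suc k) > t" by simp
  \<comment> \<open>Eigenvalues are numbered from 1, so a value above \<open>t\<close> at position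
    \<open>Suc k\<close> would give at least \<open>Suc k\<close> such values, more than
    \<open>r\<close>.\<close>
  have "{1..Suc k} \<subseteq> {i \<in> {1..n}. \<Lambda> i > t}"
  proof
    fix i assume "i \<in> {1..Suc k}"
    then obtain j where j: "i = Suc j" "j \<le> k" by (cases i) auto
    have "\<Lambda> i > t" using dec[OF j(2) k(2)] gt j(1) by simp
    then show "i \<in> {i \<in> {1..n}. \<Lambda> i > t}" using j k(2) by simp
  qed
  then have "card {1..Suc k} \<le> r" unfolding r by (intro card_mono) auto
  then show False using k(1) by simp
qed

text \<open>The two regimes meet at \<open>r = sqrt n\<close>, where
  \<open>sqrt r = n powr (1/4)\<close>. Above it, \<open>sqrt r\<close> supplies the second fourth
  root of \<open>n\<close> and \<open>sqrt (ln n)\<close> exceeds \<open>C\<close>; below it, one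
  factor \<open>sqrt r\<close> of \<open>r\<close> is replaced by
  \<open>n powr (1/4)\<close>.\<close>

lemma sqrt_count_bounds:
  fixes n r :: nat and C :: real
  assumes "0 < n" "C\<^sup>2 \<le> ln (real n)" "0 \<le> C"
  defines "B \<equiv> sqrt (real r * ln (real n)) * real n powr (1 / 4)"
  shows "sqrt (real n) \<le> real r \<Longrightarrow> C * sqrt (real n) \<le> B"
    and "real r \<le> sqrt (real n) \<Longrightarrow> real r * sqrt (ln (real n)) \<le> B"
proof -
  let ?q = "real n powr (1 / 4)"
  have q0: "0 \<le> ?q" by simp
  have "?q * ?q = real n powr (1 / 2)" by (simp add: powr_add[symmetric])
  then have q: "?q * ?q = sqrt (real n)" by (simp add: powr_half_sqrt)
  have sq: "sqrt (sqrt (real n)) = ?q" unfolding q[symmetric] by simp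
  have sC: "C \<le> sqrt (ln (real n))" using assms(2) by (rule real_le_rsqrt)
  {
    assume "sqrt (real n) \<le> real r"
    then have "?q \<le> sqrt (real r)" unfolding sq[symmetric] by (rule real_sqrt_le_mono)
    then have "?q * C \<le> sqrt (real r) * sqrt (ln (real n))"
      using sC q0 \<open>0 \<le> C\<close> by (intro mult_mono) auto
    then have "?q * C * ?q \<le> B"
      unfolding B_def real_sqrt_mult by (intro mult_right_mono) auto
    then show "C * sqrt (real n) \<le> B" unfolding q[symmetric] by (simp add: ac_simps)
  }
  {
    assume "real r \<le> sqrt (real n)"
    then have "sqrt (real r) \<le> ?q" unfolding sq[symmetric] by (rule real_sqrt_le_mono)
    then have "sqrt (real r) * (sqrt (real r) * sqrt (ln (real n))) \<le> ?q * (sqrt (real r) * sqrt (ln (real n)))"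
      using order_trans[OF \<open>0 \<le> C\<close> sC] by (intro mult_right_mono mult_nonneg_nonneg) auto
    moreover have "sqrt (real r) * (sqrt (real r) * sqrt (ln (real n))) = real r * sqrt (ln (real n))"
      by (simp add: mult.assoc[symmetric])
    ultimately show "real r * sqrt (ln (real n)) \<le> B"
      by (simp add: B_def real_sqrt_mult ac_simps)
  }
qed

lemma top_eigenvalue_perturbation_bound:
  fixes A R :: "real mat" and C K :: real
  assumes A: "A \<in> carrier_mat n n" "symmetric_mat A" and R: "R \<in> carrier_mat n n" "symmetric_mat R"
    and C: "1 \<le> C" and n: "2 \<le> n" "C\<^sup>2 \<le> ln (real n)" "C * exp (C\<^sup>2) \<le> sqrt (real n)" and K: "0 < K"
    and r: "r = card {i \<in> {1..n}. nth_eigenvalue A i > nth_eigenvalue A 1 - 3 * K * sqrt (real n)}"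
    and on: "orthonormal n n u"
    and eig: "\<And>k i. k < n \<Longrightarrow> i < n \<Longrightarrow> mv n (entries A) (u k) i = nth_eigenvalue A (Suc k) * u k i"
    and dec: "\<And>k l. k \<le> l \<Longrightarrow> l < n \<Longrightarrow> nth_eigenvalue A (Suc l) \<le> nth_eigenvalue A (Suc k)"
    and W: "\<And>x y. \<bar>bf n (entries R) x y\<bar> \<le> C * sqrt (real n) * (sqrt (ip n x x) * sqrt (ip n y y))"
    and F: "(\<Sum>k<r. \<Sum>l<r. (bf n (entries R) (u k) (u l))\<^sup>2) \<le> (real r)\<^sup>2 * ln (real n)"
  shows "nth_eigenvalue (A + R) 1 - nth_eigenvalue A 1
     \<le> 135 * ln (3 + nth_singular_value A 1)
        * max (sqrt (real n) / K) (sqrt (real r * ln (real n)) * real n powr (1/4))"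
proof -
  let ?d = "\<lambda>k. nth_eigenvalue A (Suc k)"
  define \<sigma> where "\<sigma> = nth_singular_value A 1"
  define L where "L = ln (3 + \<sigma>)"
  define B1 where "B1 = sqrt (real n) / K"
  define B2 where "B2 = sqrt (real r * ln (real n)) * real n powr (1 / 4)"
  define \<Delta> where "\<Delta> = nth_eigenvalue (A + R) 1 - nth_eigenvalue A 1"
  have n0: "0 < n" using n(1) by simp
  have sn: "0 < sqrt (real n)" using n0 by simp
  have \<sigma>: "\<bar>?d k\<bar> \<le> \<sigma>" if "k < n" for k
    unfolding \<sigma>_def by (rule abs_nth_eigenvalue_le_singular[OF A that])
  have \<sigma>0: "0 \<le> \<sigma>" using \<sigma>[OF n0] by linarith
  \<comment> \<open>The 3 inside the logarithm is at least \<open>exp 1\<close>, so \<open>L\<close>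
    is at least 1 and can be multiplied onto any nonnegative bound.\<close>
  have L1: "1 \<le> L"
    unfolding L_def using exp_le \<sigma>0 by (subst ln_ge_iff) auto
  have ln0: "0 \<le> ln (real n)" using n(2) zero_le_power2[of C] by linarith
  have B1: "0 \<le> B1" using K by (simp add: B1_def)
  have B2: "0 \<le> B2" using ln0 by (simp add: B2_def)
  have AR: "A + R \<in> carrier_mat n n" "symmetric_mat (A + R)"
    using A R symmetric_mat_add by auto
  obtain v where v: "ip n v v = 1" "bf n (entries (A + R)) v v = nth_eigenvalue (A + R) 1"
    using symmetric_mat_top_eigenvalue(2)[OF AR n0] by blast
  have \<Delta>v: "\<Delta> = bf n (entries A) v v + bf n (entries R) v v - ?d 0"
    unfolding \<Delta>_def v(2)[symmetric] bf_add_mat[OF A(1) R(1)] by simp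
  have "bf n (entries A) v v \<le> ?d 0"
    using symmetric_mat_top_eigenvalue(1)[OF A n0, of v] v(1) by simp
  moreover have "bf n (entries R) v v \<le> C * sqrt (real n)"
    using W[of v v] v(1) by simp
  ultimately have trivial: "\<Delta> \<le> C * sqrt (real n)" unfolding \<Delta>v by linarith
  have large: "\<Delta> \<le> 135 * L * max B1 B2" if "\<Delta> \<le> 135 * L * B1 \<or> \<Delta> \<le> 135 * L * B2"
  proof -
    have "135 * L * B1 \<le> 135 * L * max B1 B2" "135 * L * B2 \<le> 135 * L * max B1 B2"
      using L1 by (intro mult_left_mono; simp)+
    then show ?thesis using that by linarith
  qed
  have "\<Delta> \<le> 135 * L * max B1 B2"
  proof (cases "sqrt (real n) \<le> real r")
    case True
    have "\<Delta> \<le> C * sqrt (real n)" by (rule trivial)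
    also have "\<dots> \<le> B2"
      unfolding B2_def using sqrt_count_bounds(1)[OF n0 n(2) _ True] C by simp
    also have "\<dots> \<le> 135 * L * B2" using L1 B2 mult_right_mono[of 1 "135 * L" B2] by simp
    finally show ?thesis using large by blast
  next
    case False
    then have rn: "real r < sqrt (real n)" by simp
    also have "sqrt (real n) \<le> real n" by (rule real_le_lsqrt) (use n0 in \<open>simp_all add: power2_eq_square\<close>)
    finally have "r < n" by simp
    let ?\<tau> = "3 * K * sqrt (real n)"
    have low: "?d k \<le> ?d 0 - ?\<tau>" if "r \<le> k" "k < n" for k
      using eigenvalue_gap_of_count[where \<Lambda>="nth_eigenvalue A", OF dec r that] by simp
    \<comment> \<open>As \<open>r < n\<close>, \<open>?d r\<close> is an actual eigenvalue. It lies
      at least \<open>?\<tau>\<close> below the top one, and both have modulus at most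
      \<open>\<sigma>\<close>.\<close>
    have "?\<tau> \<le> ?d 0 - ?d r" using low[OF order_refl \<open>r < n\<close>] by simp
    also have "\<dots> \<le> 2 * \<sigma>" using \<sigma>[OF n0] \<sigma>[OF \<open>r < n\<close>] by linarith
    finally have \<tau>\<sigma>: "?\<tau> \<le> 2 * \<sigma>" .
    show ?thesis
    proof (cases "C * K \<le> 135 * L")
      case True
      then have "C * sqrt (real n) * K \<le> 135 * L * sqrt (real n)"
        using sn mult_right_mono[of "C * K" "135 * L" "sqrt (real n)"] by (simp add: ac_simps)
      then have "C * sqrt (real n) \<le> 135 * L * B1"
        using K by (simp add: B1_def pos_le_divide_eq)
      then show ?thesis using trivial large by linarith
    next
      case False
      then have CK: "135 * L < C * K" by simp
      \<comment> \<open>\<open>C * K\<close> exceeds 1, so the gap inequality makes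
        \<open>C * \<sigma>\<close> at least \<open>sqrt n\<close>. The size condition on
        \<open>n\<close> then gives \<open>\<sigma> >= exp (C^2)\<close>, so that \<open>L\<close>
        dominates \<open>C^2\<close>.\<close>
      have "sqrt (real n) \<le> C * K * sqrt (real n)"
        using CK L1 sn mult_right_mono[of 1 "C * K" "sqrt (real n)"] by simp
      also have "\<dots> \<le> C * \<sigma>"
      proof -
        have "K * sqrt (real n) \<le> \<sigma>" using \<tau>\<sigma> \<sigma>0 by linarith
        then show ?thesis using C mult_left_mono[of "K * sqrt (real n)" \<sigma> C] by (simp add: mult.assoc)
      qed
      finally have "C * exp (C\<^sup>2) \<le> C * \<sigma>" using n(3) by linarith
      then have "exp (C\<^sup>2) \<le> 3 + \<sigma>" using C by simp
      then have LC: "C\<^sup>2 \<le> L" unfolding L_def using \<sigma>0 by (subst ln_ge_iff) auto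
      \<comment> \<open>\<open>C^2 <= L\<close> and \<open>135 * L < C * K\<close> together imply
        \<open>C <= K\<close>, which secures the hypothesis \<open>2 * W <= \<tau>\<close> of
        \<open>bf_perturbed_le\<close>.\<close>
      have "C * C \<le> C * K" using CK LC L1 by (simp add: power2_eq_square)
      then have "C \<le> K" using C by simp
      then have \<tau>W: "2 * (C * sqrt (real n)) \<le> ?\<tau>"
        using sn K C mult_right_mono[of "2 * C" "3 * K" "sqrt (real n)"] by simp
      have "bf n (entries A) v v + bf n (entries R) v v
          \<le> ?d 0 + real r * sqrt (ln (real n)) + 2 * (C * sqrt (real n))\<^sup>2 / ?\<tau>"
      proof (rule bf_perturbed_le[where u=u and n=n and r=r])
        show "orthonormal n n u" by (rule on)
        show "mv n (entries A) (u k) i = ?d k * u k i" if "k < n" "i < n" for k i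
          using eig that .
        show "R $$ (i, j) = R $$ (j, i)" if "i < n" "j < n" for i j
          using symmetric_mat_entries[OF R that] .
        show "?d k \<le> ?d 0" if "k < r" for k using dec[of 0 k] that \<open>r < n\<close> by simp
        show "?d k \<le> ?d 0 - ?\<tau>" if "r \<le> k" "k < n" for k using low that .
        show "r \<le> n" using \<open>r < n\<close> by simp
        show "\<bar>bf n (entries R) x y\<bar> \<le> C * sqrt (real n) * (sqrt (ip n x x) * sqrt (ip n y y))" for x y
          by (rule W)
        show "0 \<le> C * sqrt (real n)" using C by simp
        show "2 * (C * sqrt (real n)) \<le> ?\<tau>" by (rule \<tau>W)
        show "0 < ?\<tau>" using K sn by simp
        show "(\<Sum>k<r. \<Sum>l<r. (bf n (entries R) (u k) (u l))\<^sup>2) \<le> (real r * sqrt (ln (real n)))\<^sup>2"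
          using F ln0 by (simp add: power_mult_distrib)
        show "0 \<le> real r * sqrt (ln (real n))" using ln0 by simp
        show "ip n v v = 1" by (rule v(1))
      qed
      then have "\<Delta> \<le> real r * sqrt (ln (real n)) + 2 * (C * sqrt (real n))\<^sup>2 / ?\<tau>"
        unfolding \<Delta>v by linarith
      \<comment> \<open>Here \<open>L\<close> takes the place of \<open>C^2\<close>, which keeps the
        final constant independent of the sub-Gaussian norm.\<close>
      also have "2 * (C * sqrt (real n))\<^sup>2 / ?\<tau> = 2 / 3 * (C\<^sup>2 * B1)"
        using K sn by (simp add: B1_def field_simps)
      also have "\<dots> \<le> L * B1"
        using mult_right_mono[OF LC B1] mult_nonneg_nonneg[OF zero_le_power2[of C] B1] by linarith
      also have "real r * sqrt (ln (real n)) \<le> B2"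
        unfolding B2_def using sqrt_count_bounds(2)[OF n0 n(2)] C rn by simp
      finally have "\<Delta> \<le> B2 + L * B1" by simp
      also have "\<dots> \<le> max B1 B2 + L * max B1 B2"
        using L1 by (intro add_mono mult_left_mono) auto
      also have "\<dots> \<le> L * max B1 B2 + L * max B1 B2"
        using L1 B1 mult_right_mono[of 1 L "max B1 B2"] by simp
      also have "\<dots> \<le> 135 * L * max B1 B2"
        using L1 B1 mult_nonneg_nonneg[of L "max B1 B2"] by simp
      finally show ?thesis .
    qed
  qed
  then show ?thesis by (simp add: \<Delta>_def L_def B1_def B2_def \<sigma>_def)
qed

section \<open>Probability of the good event and the limit\<close>

lemma top_eigenvalue_perturbation_probability:
  fixes A :: "real mat" and c K :: real
  assumes A: "A \<in> carrier_mat n n" "symmetric_mat A" and E: "sub_gaussian_matrix C1 C2 M n E"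
    and c: "C2 < c" "0 < c" and C: "C = 2 * (2 * c\<^sup>2 + 19)"
    and n: "2 \<le> n" "C\<^sup>2 \<le> ln (real n)" "C * exp (C\<^sup>2) \<le> sqrt (real n)" and K: "0 < K"
    and r: "r = card {i \<in> {1..n}. nth_eigenvalue A i > nth_eigenvalue A 1 - 3 * K * sqrt (real n)}"
  shows "1 - (2 * exp (- real n) + 8 * exp (2 * c\<^sup>2) / ln (real n)) \<le>
    measure M {\<omega> \<in> space M. nth_eigenvalue (A + E \<omega>) 1 - nth_eigenvalue A 1
       \<le> 135 * ln (3 + nth_singular_value A 1)
          * max (sqrt (real n) / K) (sqrt (real r * ln (real n)) * real n powr (1/4))}"
proof (rule symmetric_mat_spectral[OF A])
  fix u assume on: "orthonormal n n u"
    and eig: "\<And>k i. k < n \<Longrightarrow> i < n \<Longrightarrow> mv n (entries A) (u k) i = nth_eigenvalue A (Suc k) * u k i"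
    and dec: "\<And>k l. k \<le> l \<Longrightarrow> l < n \<Longrightarrow> nth_eigenvalue A (Suc l) \<le> nth_eigenvalue A (Suc k)"
  interpret prob_space M using E by (simp add: sub_gaussian_matrix_def)
  define b where "b = 135 * ln (3 + nth_singular_value A 1)
          * max (sqrt (real n) / K) (sqrt (real r * ln (real n)) * real n powr (1/4))"
  define T where "T = {\<omega> \<in> space M. nth_eigenvalue (A + E \<omega>) 1 - nth_eigenvalue A 1 \<le> b}"
  define N where "N = {\<omega> \<in> space M. \<exists>m\<in>lattice_net n. 16 * real n * ((2 * c\<^sup>2 + 19) * sqrt n)
      < \<bar>bf n (entries (E \<omega>)) (\<lambda>i. of_int (m i)) (\<lambda>i. of_int (m i))\<bar>}"
  define P where "P = {\<omega> \<in> space M. (real r)\<^sup>2 * ln (real n)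
      < (\<Sum>k<r. \<Sum>l<r. (bf n (entries (E \<omega>)) (u k) (u l))\<^sup>2)}"
  note [measurable] = sub_gaussian_matrix_bf_measurable[OF E]
  have n0: "0 < n" using n(1) by simp
  have ln0: "0 < ln (real n)" using n(1) by simp
  have C1: "1 \<le> C" unfolding C by (simp add: add_increasing)
  have rn: "r \<le> n"
    unfolding r by (rule order_trans[OF card_mono[of "{1..n}"]]) auto
  \<comment> \<open>The top eigenvalue counts itself because \<open>K > 0\<close>, so the
    compression is not empty.\<close>
  have "1 \<in> {i \<in> {1..n}. nth_eigenvalue A i > nth_eigenvalue A 1 - 3 * K * sqrt (real n)}"
    using n0 K by simp
  then have r0: "0 < r" unfolding r by (intro card_gt_0_iff[THEN iffD2]) auto
  have "N = (\<Union>m\<in>lattice_net n. {\<omega> \<in> space M. 16 * real n * ((2 * c\<^sup>2 + 19) * sqrt n)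
      < \<bar>bf n (entries (E \<omega>)) (\<lambda>i. of_int (m i)) (\<lambda>i. of_int (m i))\<bar>})"
    by (auto simp: N_def)
  also have "\<dots> \<in> sets M"
    by (intro sets.finite_UN finite_lattice_net) measurable
  finally have Nm: "N \<in> sets M" .
  have Pm: "P \<in> sets M" unfolding P_def by measurable
  \<comment> \<open>Measurability of \<open>T\<close> precedes the passage to complements:
    \<open>measure\<close> is 0 by default on a non-measurable set.\<close>
  have "T = {\<omega> \<in> space M. nth_eigenvalue (A + E \<omega>) 1 \<le> b + nth_eigenvalue A 1}"
    unfolding T_def diff_le_eq ..
  then have Tm: "T \<in> sets M"
    using measurable_top_eigenvalue_le[OF E A n0, of "b + nth_eigenvalue A 1"] by metis
  have onr: "orthonormal n r u" using on rn unfolding orthonormal_def by auto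
  have "emeasure M N \<le> ennreal (2 * exp (- real n))"
    unfolding N_def by (rule sub_gaussian_matrix_net_tail[OF E c n0])
  then have pN: "prob N \<le> 2 * exp (- real n)"
    by (simp add: emeasure_eq_measure)
  have "emeasure M P \<le> ennreal (8 * exp (2 * c\<^sup>2) / ln (real n))"
    unfolding P_def by (rule sub_gaussian_matrix_block_tail[OF E c onr r0 ln0])
  then have pP: "prob P \<le> 8 * exp (2 * c\<^sup>2) / ln (real n)"
    using ln0 by (simp add: emeasure_eq_measure)
  have sub: "space M - T \<subseteq> N \<union> P"
  proof
    fix \<omega> assume \<omega>: "\<omega> \<in> space M - T"
    show "\<omega> \<in> N \<union> P"
    proof (rule ccontr)
      assume no: "\<omega> \<notin> N \<union> P"
      have R: "E \<omega> \<in> carrier_mat n n" "symmetric_mat (E \<omega>)"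
        using E \<omega> by (auto simp: sub_gaussian_matrix_def)
      have net: "\<bar>bf n (entries (E \<omega>)) (\<lambda>i. of_int (m i)) (\<lambda>i. of_int (m i))\<bar>
          \<le> 16 * real n * ((2 * c\<^sup>2 + 19) * sqrt n)" if "m \<in> lattice_net n" for m
        using no \<omega> that by (auto simp: N_def not_less)
      have "\<bar>bf n (entries (E \<omega>)) x y\<bar> \<le> 2 * ((2 * c\<^sup>2 + 19) * sqrt n) * (sqrt (ip n x x) * sqrt (ip n y y))" for x y
        by (rule bf_le_of_lattice_net[OF symmetric_mat_entries[OF R] _ net]) auto
      \<comment> \<open>The net argument doubles its threshold, which is the outer factor 2 in
        \<open>C\<close>.\<close>
      then have W: "\<bar>bf n (entries (E \<omega>)) x y\<bar> \<le> C * sqrt n * (sqrt (ip n x x) * sqrt (ip n y y))" for x y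
        unfolding C by (simp only: mult.assoc)
      have F: "(\<Sum>k<r. \<Sum>l<r. (bf n (entries (E \<omega>)) (u k) (u l))\<^sup>2) \<le> (real r)\<^sup>2 * ln (real n)"
        using no \<omega> by (auto simp: P_def not_less)
      have "nth_eigenvalue (A + E \<omega>) 1 - nth_eigenvalue A 1 \<le> b"
        unfolding b_def by (rule top_eigenvalue_perturbation_bound[OF A R C1 n K r on eig dec W F])
      then show False using \<omega> by (simp add: T_def)
    qed
  qed
  have "1 - prob T = prob (space M - T)" by (rule prob_compl[OF Tm, symmetric])
  also have "\<dots> \<le> prob (N \<union> P)" using sub Nm Pm by (intro finite_measure_mono) auto
  also have "\<dots> \<le> prob N + prob P" using Nm Pm by (rule measure_Un_le)
  finally have "1 - (2 * exp (- real n) + 8 * exp (2 * c\<^sup>2) / ln (real n)) \<le> prob T"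
    using pN pP by linarith
  then show "1 - (2 * exp (- real n) + 8 * exp (2 * c\<^sup>2) / ln (real n)) \<le>
    prob {\<omega> \<in> space M. nth_eigenvalue (A + E \<omega>) 1 - nth_eigenvalue A 1
       \<le> 135 * ln (3 + nth_singular_value A 1)
          * max (sqrt (real n) / K) (sqrt (real r * ln (real n)) * real n powr (1/4))}"
    unfolding T_def b_def .
qed

theorem theorem2p1:
  fixes A :: "nat \<Rightarrow> real mat"
    and M :: "nat \<Rightarrow> 'a measure"
    and E :: "nat \<Rightarrow> 'a \<Rightarrow> real mat"
    and K :: "nat \<Rightarrow> real"
    and r :: "nat \<Rightarrow> nat"
    and C1 C2 :: real
  assumes "C1 > 0" and "C2 > 0"
    and "\<And>n. A n \<in> carrier_mat n n"
    and "\<And>n. symmetric_mat (A n)"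
    and "\<And>n. sub_gaussian_matrix C1 C2 (M n) n (E n)"
    and "\<And>n. K n > 0"
    and "\<And>n. r n = card {i \<in> {1..n}.
           nth_eigenvalue (A n) i > nth_eigenvalue (A n) 1 - 3 * K n * sqrt (real n)}"
  shows "(\<lambda>n. measure (M n) {\<omega> \<in> space (M n).
            nth_eigenvalue (A n + E n \<omega>) 1 - nth_eigenvalue (A n) 1
              \<le> 135 * ln (3 + nth_singular_value (A n) 1)
                 * max (sqrt (real n) / K n)
                       (sqrt (real (r n) * ln (real n)) * real n powr (1/4))})
          \<longlonglongrightarrow> 1"
proof -
  \<comment> \<open>Any number above \<open>C2\<close> would do; strictness serves to pass from the
    infimum in \<open>psi2_norm\<close> to an actual scale.\<close>
  define c where "c = C2 + 1"
  have c: "C2 < c" "0 < c" using \<open>C2 > 0\<close> by (auto simp: c_def)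
  define C where "C = 2 * (2 * c\<^sup>2 + 19)"
  have ln: "filterlim (\<lambda>n. ln (real n)) at_top sequentially"
    by (rule filterlim_compose[OF ln_at_top filterlim_real_sequentially])
  have sqrt: "filterlim (\<lambda>n. sqrt (real n)) at_top sequentially"
    by (rule filterlim_compose[OF sqrt_at_top filterlim_real_sequentially])
  have "(\<lambda>n. exp (- real n)) \<longlonglongrightarrow> 0"
    by (rule filterlim_compose[OF exp_at_bot])
       (simp add: filterlim_uminus_at_bot filterlim_real_sequentially)
  moreover have "(\<lambda>n. 8 * exp (2 * c\<^sup>2) / ln (real n)) \<longlonglongrightarrow> 0"
    by (rule tendsto_divide_0[OF tendsto_const filterlim_at_top_imp_at_infinity[OF ln]])
  ultimately have "(\<lambda>n. 1 - (2 * exp (- real n) + 8 * exp (2 * c\<^sup>2) / ln (real n))) \<longlonglongrightarrow> 1 - (2 * 0 + 0)"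
    by (intro tendsto_intros)
  then have lower: "(\<lambda>n. 1 - (2 * exp (- real n) + 8 * exp (2 * c\<^sup>2) / ln (real n))) \<longlonglongrightarrow> 1" by simp
  show ?thesis
  proof (rule tendsto_sandwich[OF _ _ lower tendsto_const])
    \<comment> \<open>These thresholds involve only \<open>C\<close>, hence only \<open>C2\<close>,
      so they hold from some \<open>n\<close> on whatever \<open>A n\<close> and \<open>K n\<close>
      are.\<close>
    have "\<forall>\<^sub>F n in sequentially. 2 \<le> n \<and> C\<^sup>2 \<le> ln (real n) \<and> C * exp (C\<^sup>2) \<le> sqrt (real n)"
      using ln sqrt eventually_ge_at_top[of 2] by (simp add: filterlim_at_top eventually_conj_iff)
    then show "\<forall>\<^sub>F n in sequentially. 1 - (2 * exp (- real n) + 8 * exp (2 * c\<^sup>2) / ln (real n))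
      \<le> measure (M n) {\<omega> \<in> space (M n).
            nth_eigenvalue (A n + E n \<omega>) 1 - nth_eigenvalue (A n) 1
              \<le> 135 * ln (3 + nth_singular_value (A n) 1)
                 * max (sqrt (real n) / K n)
                       (sqrt (real (r n) * ln (real n)) * real n powr (1/4))}"
    proof (rule eventually_mono)
      fix n assume n: "2 \<le> n \<and> C\<^sup>2 \<le> ln (real n) \<and> C * exp (C\<^sup>2) \<le> sqrt (real n)"
      show "1 - (2 * exp (- real n) + 8 * exp (2 * c\<^sup>2) / ln (real n))
      \<le> measure (M n) {\<omega> \<in> space (M n).
            nth_eigenvalue (A n + E n \<omega>) 1 - nth_eigenvalue (A n) 1
              \<le> 135 * ln (3 + nth_singular_value (A n) 1)
                 * max (sqrt (real n) / K n)
                       (sqrt (real (r n) * ln (real n)) * real n powr (1/4))}"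
        by (rule top_eigenvalue_perturbation_probability[OF assms(3-5) c C_def _ _ _ assms(6,7)])
           (use n in blast)+
    qed
    have "prob_space (M n)" for n using assms(5)[of n] by (simp add: sub_gaussian_matrix_def)
    then show "\<forall>\<^sub>F n in sequentially. measure (M n) {\<omega> \<in> space (M n).
            nth_eigenvalue (A n + E n \<omega>) 1 - nth_eigenvalue (A n) 1
              \<le> 135 * ln (3 + nth_singular_value (A n) 1)
                 * max (sqrt (real n) / K n)
                       (sqrt (real (r n) * ln (real n)) * real n powr (1/4))} \<le> 1"
      by (simp add: prob_space.prob_le_1)
  qed
qed

end
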